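(* Let $n\ge1$, let $\sigma$ be an endomorphism of the free MV-algebra $\mathrm{Free}_n(MV)$, let $S:[0,1]^n\to[0,1]^n$ be the McNaughton mapping induced by $\sigma$, let $p\in[0,1]^n$ and $q=S(p)$, and let $\mathfrak{m}=\pi(p)$, $\mathfrak{n}=\pi(q)$ be the corresponding maximal filters. Let $$\bar\sigma:\mathfrak{n}/\mathfrak{g}_{\mathfrak{n}}\to\mathfrak{m}/\mathfrak{g}_{\mathfrak{m}}$$ be the homomorphism of lattice-ordered abelian groups determined by $\sigma$, and let $$\bar\sigma':\ell\text{-}\mathrm{Hom}(\mathfrak{m}/\mathfrak{g}_{\mathfrak{m}},\mathbb{R})\to\ell\text{-}\mathrm{Hom}(\mathfrak{n}/\mathfrak{g}_{\mathfrak{n}},\mathbb{R}),\qquad \bar\sigma'(\varphi)=\varphi\circ\bar\sigma .$$ Then, under the identification of tangent vectors with $\ell$-homomorphisms via evaluation maps $w\mapsto\varphi_w$, the map $\bar\sigma'$ corresponds to Tsujii's differential $\mathcal{D}_pS$ of $S$ at $p$; that is, for every tangent vector $v\in K_p$, $$\bar\sigma'(\varphi_v\circ D_p)=\varphi_{(\mathcal{D}_pS)(v)}\circ D_q .$$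
   Context: MV-algebras and McNaughton mappings. Equip $[0,1]$ with the Łukasiewicz operations $a\star b=\max(a+b-1,0)$, $a\to b=\min(1,1-a+b)$ and constants $0,1$; $MV$ is the equational class generated by $([0,1],\star,\to,0,1)$. $\mathrm{Free}_n(MV)$ is the algebra of all functions $[0,1]^n\to[0,1]$ obtained from the coordinate projections $x_0,\dots,x_{n-1}$ and the constants $0,1$ by pointwise application of $\star,\to$; by McNaughton's theorem these are exactly the continuous functions $[0,1]^n\to[0,1]$ that are piecewise affine linear with finitely many pieces, all with integer coefficients. The mapping induced by an endomorphism $\sigma$ is $S(p)=(\sigma(x_0)(p),\dots,\sigma(x_{n-1})(p))$, so that $\sigma(r)=r\circ S$. Filters. A filter is the preimage of $1$ under a homomorphism of MV-algebras; it is prime if the quotient by it is a nontrivial totally ordered algebra. For $p\in[0,1]^n$, $\pi(p)=\{r\in\mathrm{Free}_n(MV): r(p)=1\}$, a maximal (hence prime) filter. For a prime filter $\mathfrak{p}$, the germinal filter $\mathfrak{g}_{\mathfrak{p}}$ is the intersection of all prime filters contained in $\mathfrak{p}$. For $\mathfrak{m}=\pi(p)$, the quotient $A_p=\mathrm{Free}_n(MV)/\mathfrak{g}_{\mathfrak{m}}$ is the MV-algebra of germs at $p$ (in $[0,1]^n$) of McNaughton functions. $\ell$-groups. An $\ell$-group is a lattice-ordered abelian group; $\ell$-homomorphisms are group homomorphisms that are lattice homomorphisms; $\ell\text{-}\mathrm{Hom}(G,\mathbb{R})$ is the set of $\ell$-homomorphisms $G\to\mathbb{R}$. Under Mundici's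 equivalence $\Gamma$ between $\ell$-groups with strong unit and MV-algebras, filters of $\Gamma(G,u)$ correspond to kernels of $\ell$-homomorphisms on $G$; the maximal filter $\mathfrak{m}/\mathfrak{g}_{\mathfrak{m}}$ of $A_p$ is regarded as the corresponding $\ell$-group. Concretely, $\mathfrak{m}/\mathfrak{g}_{\mathfrak{m}}$ is the $\ell$-group of germs at $p$ of those continuous functions $g:[0,1]^n\to\mathbb{R}$ that are piecewise affine linear (finitely many pieces) with integer coefficients and satisfy $g(p)=0$; similarly $\mathfrak{n}/\mathfrak{g}_{\mathfrak{n}}$ at $q$. The map $\bar\sigma$ sends the germ of $g$ at $q$ to the germ of $g\circ S$ at $p$. Tangent vectors and identifications. $K_p=\{v\in\mathbb{R}^n: p+hv\in[0,1]^n\text{ for all sufficiently small }h>0\}$; thus $K_p=\mathbb{R}^n$ when $p$ is interior. $D_p$ maps the germ of $g$ at $p$ to the function $K_p\to\mathbb{R}$ given by $$[D_p(g)](w)=\lim_{h\to0^+}\frac{g(p+hw)-g(p)}{h},$$ and $D_q$ is defined analogously at $q$. For a function $f$ and a point $w$ of its domain, $\varphi_w(f)=f(w)$. $F\ell(n)$, the free $\ell$-group on $n$ generators, is the $\ell$-group of continuous piecewise homogeneous-linear functions $\mathbb{R}^n\to\mathbb{R}$ with integer coefficients, and $w\mapsto\varphi_w$ is a bijection from $\mathbb{R}^n$ onto $\ell\text{-}\mathrm{Hom}(F\ell(n),\mathbb{R})$. When $p$ has rational coordinates and is interior, $D_p$ is an $\ell$-isomorphism of $\mathfrak{m}/\mathfrak{g}_{\mathfrak{m}}$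 onto $F\ell(n)$, so that $v\mapsto\varphi_v\circ D_p$ identifies $\mathbb{R}^n$ with $\ell\text{-}\mathrm{Hom}(\mathfrak{m}/\mathfrak{g}_{\mathfrak{m}},\mathbb{R})$. Tsujii's differential of $S$ at $p$ is $$(\mathcal{D}_pS)(v)=\lim_{h\to0^+}\frac{S(p+hv)-S(p)}{h},\qquad v\in K_p .$$ *)

theory Defs
  imports "HOL-Analysis.Analysis" "HOL-Algebra.Coset"
begin

text \<open>
  The index set of the coordinates is an arbitrary finite type \<open>'n\<close>, so that \<open>n = CARD('n) \<ge> 1\<close>.
  Functions with a restricted domain are extensional (value \<open>undefined\<close> outside the domain),
  so that HOL equality is equality on the domain.
\<close>

section \<open>MV-algebras\<close>

definition luk_star :: "real \<Rightarrow> real \<Rightarrow> real" where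
  "luk_star a b = max (a + b - 1) 0"

definition luk_imp :: "real \<Rightarrow> real \<Rightarrow> real" where
  "luk_imp a b = min 1 (1 - a + b)"

record 'a mv_alg = "'a partial_object" +
  mvstar :: "'a \<Rightarrow> 'a \<Rightarrow> 'a"
  mvimp :: "'a \<Rightarrow> 'a \<Rightarrow> 'a"
  mvzero :: 'a
  mvone :: 'a

definition unit_mv :: "real mv_alg" where
  "unit_mv = \<lparr>carrier = {0..1}, mvstar = luk_star, mvimp = luk_imp, mvzero = 0, mvone = 1\<rparr>"

datatype mv_term = MVar nat | MZero | MOne | MStar mv_term mv_term | MImp mv_term mv_term

primrec mv_eval :: "'a mv_alg \<Rightarrow> (nat \<Rightarrow> 'a) \<Rightarrow> mv_term \<Rightarrow> 'a" where
  "mv_eval A e (MVar i) = e i"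
| "mv_eval A e MZero = mvzero A"
| "mv_eval A e MOne = mvone A"
| "mv_eval A e (MStar s t) = mvstar A (mv_eval A e s) (mv_eval A e t)"
| "mv_eval A e (MImp s t) = mvimp A (mv_eval A e s) (mv_eval A e t)"

definition mv_valid :: "'a mv_alg \<Rightarrow> mv_term \<Rightarrow> mv_term \<Rightarrow> bool" where
  "mv_valid A s t \<longleftrightarrow> (\<forall>e \<in> UNIV \<rightarrow> carrier A. mv_eval A e s = mv_eval A e t)"

text \<open>The equational class generated by \<open>[0,1]\<close>: all algebras satisfying every identity of \<open>[0,1]\<close>.\<close>

definition mv_algebra :: "'a mv_alg \<Rightarrow> bool" where
  "mv_algebra A \<longleftrightarrow>
     mvzero A \<in> carrier A \<and> mvone A \<in> carrier A \<and>
     (\<forall>a \<in> carrier A. \<forall>b \<in> carrier A. mvstar A a b \<in> carrier A \<and> mvimp A a b \<in> carrier A) \<and>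
     (\<forall>s t. mv_valid unit_mv s t \<longrightarrow> mv_valid A s t)"

definition mv_hom :: "'a mv_alg \<Rightarrow> 'b mv_alg \<Rightarrow> ('a \<Rightarrow> 'b) set" where
  "mv_hom A B = {h \<in> carrier A \<rightarrow> carrier B.
     h (mvzero A) = mvzero B \<and> h (mvone A) = mvone B \<and>
     (\<forall>a \<in> carrier A. \<forall>b \<in> carrier A.
        h (mvstar A a b) = mvstar B (h a) (h b) \<and> h (mvimp A a b) = mvimp B (h a) (h b))}"

definition mv_kernel :: "'a mv_alg \<Rightarrow> 'b mv_alg \<Rightarrow> ('a \<Rightarrow> 'b) \<Rightarrow> 'a set" where
  "mv_kernel A B h = {a \<in> carrier A. h a = mvone B}"

text \<open>
  The order of an MV-algebra is \<open>a \<le> b\<close> iff \<open>a \<rightarrow> b = 1\<close>.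
\<close>

definition mv_nontrivial_chain :: "'a mv_alg \<Rightarrow> bool" where
  "mv_nontrivial_chain B \<longleftrightarrow> mvzero B \<noteq> mvone B \<and>
     (\<forall>a \<in> carrier B. \<forall>b \<in> carrier B. mvimp B a b = mvone B \<or> mvimp B b a = mvone B)"

text \<open>
  Filters are the sets \<open>mv_kernel A B h\<close>, the preimages of \<open>1\<close> under homomorphisms.  If \<open>h\<close> maps
  \<open>A\<close> onto \<open>B\<close>, then \<open>B\<close> is (a copy of) the quotient of \<open>A\<close> by the filter.  Since one cannot quantify
  over types inside a definition, \<open>B\<close> is taken over the type \<open>'a set\<close>; this loses nothing, as
  the quotient of \<open>A\<close> consists of subsets of the carrier of \<open>A\<close>.
\<close>

definition prime_mv_filter :: "'a mv_alg \<Rightarrow> 'a set \<Rightarrow> bool" where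
  "prime_mv_filter A F \<longleftrightarrow>
     (\<exists>(B :: 'a set mv_alg) h. mv_algebra B \<and> h \<in> mv_hom A B \<and> h ` carrier A = carrier B \<and>
        F = mv_kernel A B h \<and> mv_nontrivial_chain B)"

definition germinal_filter :: "'a mv_alg \<Rightarrow> 'a set \<Rightarrow> 'a set" where
  "germinal_filter A P = \<Inter> {Q. prime_mv_filter A Q \<and> Q \<subseteq> P}"


section \<open>The free MV-algebra and McNaughton mappings\<close>

definition cube :: "(real ^ 'n) set" where
  "cube = {x. \<forall>i. 0 \<le> x $ i \<and> x $ i \<le> 1}"

definition coord :: "'n \<Rightarrow> real ^ 'n \<Rightarrow> real" where
  "coord i = (\<lambda>x\<in>cube. x $ i)"

inductive_set free_carrier :: "(real ^ 'n \<Rightarrow> real) set" where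
  coord: "coord i \<in> free_carrier"
| zero: "(\<lambda>x\<in>cube. 0) \<in> free_carrier"
| one: "(\<lambda>x\<in>cube. 1) \<in> free_carrier"
| star: "r \<in> free_carrier \<Longrightarrow> s \<in> free_carrier \<Longrightarrow> (\<lambda>x\<in>cube. luk_star (r x) (s x)) \<in> free_carrier"
| imp: "r \<in> free_carrier \<Longrightarrow> s \<in> free_carrier \<Longrightarrow> (\<lambda>x\<in>cube. luk_imp (r x) (s x)) \<in> free_carrier"

definition free_mv :: "(real ^ 'n \<Rightarrow> real) mv_alg" where
  "free_mv = \<lparr>carrier = free_carrier,
     mvstar = (\<lambda>r s. \<lambda>x\<in>cube. luk_star (r x) (s x)),
     mvimp = (\<lambda>r s. \<lambda>x\<in>cube. luk_imp (r x) (s x)),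
     mvzero = (\<lambda>x\<in>cube. 0), mvone = (\<lambda>x\<in>cube. 1)\<rparr>"

definition induced_map ::
    "((real ^ 'n \<Rightarrow> real) \<Rightarrow> real ^ 'n \<Rightarrow> real) \<Rightarrow> real ^ 'n \<Rightarrow> real ^ 'n" where
  "induced_map \<sigma> = (\<lambda>x\<in>cube. \<chi> i. \<sigma> (coord i) x)"

text \<open>The maximal filter \<open>\<pi>(p)\<close>.\<close>

definition point_filter :: "real ^ 'n \<Rightarrow> (real ^ 'n \<Rightarrow> real) set" where
  "point_filter p = {r \<in> carrier free_mv. r p = 1}"


section \<open>Lattice-ordered abelian groups\<close>

text \<open>The group operation is written with the multiplicative field names of \<open>HOL-Algebra\<close>.\<close>

record 'a lgrp = "'a monoid" +
  ljoin :: "'a \<Rightarrow> 'a \<Rightarrow> 'a"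
  lmeet :: "'a \<Rightarrow> 'a \<Rightarrow> 'a"

definition lgroup :: "'a lgrp \<Rightarrow> bool" where
  "lgroup G \<longleftrightarrow> comm_group G \<and>
     (\<forall>a \<in> carrier G. \<forall>b \<in> carrier G.
        ljoin G a b \<in> carrier G \<and> lmeet G a b \<in> carrier G \<and>
        ljoin G a b = ljoin G b a \<and> lmeet G a b = lmeet G b a \<and>
        ljoin G a (lmeet G a b) = a \<and> lmeet G a (ljoin G a b) = a) \<and>
     (\<forall>a \<in> carrier G. \<forall>b \<in> carrier G. \<forall>c \<in> carrier G.
        ljoin G (ljoin G a b) c = ljoin G a (ljoin G b c) \<and>
        lmeet G (lmeet G a b) c = lmeet G a (lmeet G b c) \<and>
        mult G c (ljoin G a b) = ljoin G (mult G c a) (mult G c b) \<and>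
        mult G c (lmeet G a b) = lmeet G (mult G c a) (mult G c b))"

definition real_lgrp :: "real lgrp" where
  "real_lgrp = \<lparr>carrier = UNIV, mult = (+), one = 0, ljoin = max, lmeet = min\<rparr>"

definition lgroup_hom :: "'a lgrp \<Rightarrow> 'b lgrp \<Rightarrow> ('a \<Rightarrow> 'b) set" where
  "lgroup_hom G H = {\<phi> \<in> carrier G \<rightarrow>\<^sub>E carrier H. \<forall>a \<in> carrier G. \<forall>b \<in> carrier G.
     \<phi> (mult G a b) = mult H (\<phi> a) (\<phi> b) \<and>
     \<phi> (ljoin G a b) = ljoin H (\<phi> a) (\<phi> b) \<and>
     \<phi> (lmeet G a b) = lmeet H (\<phi> a) (\<phi> b)}"


section \<open>The \<open>\<ell>\<close>-group of a maximal filter modulo its germinal filter\<close>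

definition int_affine :: "(real ^ 'n \<Rightarrow> real) \<Rightarrow> bool" where
  "int_affine f \<longleftrightarrow>
     (\<exists>(a :: 'n \<Rightarrow> int) (b :: int). \<forall>x. f x = (\<Sum>i\<in>UNIV. of_int (a i) * x $ i) + of_int b)"

text \<open>Continuous piecewise affine functions on the cube, finitely many pieces, integer coefficients.\<close>

definition int_pl :: "(real ^ 'n \<Rightarrow> real) set" where
  "int_pl = {g \<in> extensional cube. continuous_on cube g \<and>
     (\<exists>P. finite P \<and> (\<forall>f\<in>P. int_affine f) \<and> (\<forall>x\<in>cube. \<exists>f\<in>P. g x = f x))}"

definition pl_lgrp :: "(real ^ 'n \<Rightarrow> real) lgrp" where
  "pl_lgrp = \<lparr>carrier = int_pl, mult = (\<lambda>f g. \<lambda>x\<in>cube. f x + g x), one = (\<lambda>x\<in>cube. 0),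
     ljoin = (\<lambda>f g. \<lambda>x\<in>cube. max (f x) (g x)), lmeet = (\<lambda>f g. \<lambda>x\<in>cube. min (f x) (g x))\<rparr>"

text \<open>
  \<open>Free\<^sub>n(MV) = \<Gamma>(pl_lgrp, 1)\<close>.  Under \<open>\<Gamma>\<close> a filter \<open>F\<close> corresponds to the convex \<open>\<ell>\<close>-subgroup
  (kernel of an \<open>\<ell>\<close>-homomorphism) generated by the functions \<open>1 - r\<close>, \<open>r \<in> F\<close>, which is the
  following set because \<open>F\<close> is closed under \<open>star\<close>.  Equivalently (McNaughton), it is
  the set of all \<open>g\<close> with \<open>1 - min \<bar>g\<bar> 1 \<in> F\<close>.  For \<open>F = \<pi>(p)\<close> this says \<open>g p = 0\<close>;
  for the germinal filter of \<open>\<pi>(p)\<close> it says that \<open>g\<close> vanishes in a neighbourhood of \<open>p\<close>.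
\<close>

definition filter_ideal :: "(real ^ 'n \<Rightarrow> real) set \<Rightarrow> (real ^ 'n \<Rightarrow> real) set" where
  "filter_ideal F =
     {g \<in> int_pl. \<exists>r\<in>F. \<exists>k::nat. \<forall>x\<in>cube. \<bar>g x\<bar> \<le> of_nat k * (1 - r x)}"

text \<open>
  The germ of \<open>g\<close> at \<open>p\<close> (for \<open>\<mm> = \<pi>(p)\<close>): the coset of \<open>g\<close> modulo the \<open>\<ell>\<close>-ideal of the
  germinal filter of \<open>\<mm>\<close>.
\<close>

definition germ :: "(real ^ 'n \<Rightarrow> real) set \<Rightarrow> (real ^ 'n \<Rightarrow> real) \<Rightarrow> (real ^ 'n \<Rightarrow> real) set" where
  "germ \<mm> g = filter_ideal (germinal_filter free_mv \<mm>) #>\<^bsub>pl_lgrp\<^esub> g"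

definition germ_lgrp :: "(real ^ 'n \<Rightarrow> real) set \<Rightarrow> (real ^ 'n \<Rightarrow> real) set lgrp" where
  "germ_lgrp \<mm> = \<lparr>carrier = germ \<mm> ` filter_ideal \<mm>,
     mult = (\<lambda>X Y. X <#>\<^bsub>pl_lgrp\<^esub> Y),
     one = germ \<mm> (\<lambda>x\<in>cube. 0),
     ljoin = (\<lambda>X Y. \<Union>f\<in>X. \<Union>g\<in>Y. germ \<mm> (ljoin pl_lgrp f g)),
     lmeet = (\<lambda>X Y. \<Union>f\<in>X. \<Union>g\<in>Y. germ \<mm> (lmeet pl_lgrp f g))\<rparr>"

text \<open>\<open>germ of g at q \<mapsto> germ of g \<circ> S at p\<close>, where \<open>\<nn> = \<pi>(q)\<close> and \<open>\<mm> = \<pi>(p)\<close>.\<close>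

definition germ_pullback ::
    "(real ^ 'n \<Rightarrow> real ^ 'n) \<Rightarrow> (real ^ 'n \<Rightarrow> real) set \<Rightarrow> (real ^ 'n \<Rightarrow> real) set \<Rightarrow>
     (real ^ 'n \<Rightarrow> real) set \<Rightarrow> (real ^ 'n \<Rightarrow> real) set" where
  "germ_pullback S \<nn> \<mm> =
     (\<lambda>X\<in>carrier (germ_lgrp \<nn>). the_elem ((\<lambda>g. germ \<mm> (compose cube g S)) ` X))"


section \<open>Tangent vectors and differentials\<close>

definition tangent_cone :: "real ^ 'n \<Rightarrow> (real ^ 'n) set" where
  "tangent_cone p = {v. \<forall>\<^sub>F h in at_right 0. p + h *\<^sub>R v \<in> cube}"

text \<open>
  \<open>D\<^sub>p\<close> on a germ \<open>X\<close> at \<open>p\<close>; the one-sided derivative is required to be common to all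
  representatives of \<open>X\<close>.
\<close>

definition germ_diff ::
    "real ^ 'n \<Rightarrow> (real ^ 'n \<Rightarrow> real) set \<Rightarrow> real ^ 'n \<Rightarrow> real" where
  "germ_diff p X = (\<lambda>w\<in>tangent_cone p.
     THE d. \<forall>g\<in>X. ((\<lambda>h. (g (p + h *\<^sub>R w) - g p) / h) \<longlongrightarrow> d) (at_right 0))"

definition eval_at :: "'a \<Rightarrow> ('a \<Rightarrow> 'b) \<Rightarrow> 'b" where
  "eval_at w f = f w"

definition tsujii_diff :: "(real ^ 'n \<Rightarrow> real ^ 'n) \<Rightarrow> real ^ 'n \<Rightarrow> real ^ 'n \<Rightarrow> real ^ 'n" where
  "tsujii_diff S p = (\<lambda>v\<in>tangent_cone p.
     Lim (at_right 0) (\<lambda>h. (1 / h) *\<^sub>R (S (p + h *\<^sub>R v) - S p)))"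

end

theory Submission
  imports Defs
begin

text \<open>
  Everything happens along rays.  A continuous piecewise affine function \<open>g\<close> on the cube is affine
  on a short initial segment of the ray from \<open>p\<close> in a direction \<open>w\<close>: there is a number \<open>d\<close> with
  \<open>g (p + h w) = g p + h d\<close> for all small \<open>h > 0\<close> (\<open>int_pl_eventually_linear_on_ray\<close>).  So one-sided
  directional derivatives exist and are values of difference quotients.  Applied to the coordinates
  of \<open>S\<close>, this gives \<open>S (p + h v) = q + h w\<close> for small \<open>h > 0\<close>, where \<open>w\<close> is Tsujii's differential
  at \<open>v\<close>.  The difference quotient of \<open>g \<circ> S\<close> at \<open>p\<close> in direction \<open>v\<close> then coincides for small \<open>h\<close>
  with that of \<open>g\<close> at \<open>q\<close> in direction \<open>w\<close>, and the asserted identity is the equality of the limits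
  (\<open>germ_diff_compose\<close>).

  The remaining point is that these statements make sense for germs, which are cosets modulo
  the ideal of the germinal filter.  Two facts about prime filters carry this.
  First, for every tangent direction \<open>w\<close> the functions equal to \<open>1\<close> on an initial segment of the
  ray form a prime filter below \<open>\<pi>(p)\<close>, because functions of one variable that are affine near
  \<open>0+\<close> are totally ordered there (\<open>prime_ray_filter\<close>).  Members of the germinal ideal
  therefore vanish on an initial segment of each ray, and derivatives depend on the germ alone.
  Second, \<open>\<sigma>\<close> pulls back prime filters below \<open>\<pi>(p)\<close> to prime filters below \<open>\<pi>(q)\<close>
  (\<open>prime_mv_filter_preimage\<close>), so composition with \<open>S\<close> maps the germinal ideal at \<open>q\<close> into that at
  \<open>p\<close> (\<open>endo_germinal_filter\<close>).
\<close>

section \<open>Piecewise affine functions on the cube\<close>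

lemma int_affine_const: "int_affine (\<lambda>x. of_int c)"
  unfolding int_affine_def by (intro exI[of _ "\<lambda>_. 0"] exI[of _ c]) simp

lemma int_affine_proj: "int_affine (\<lambda>x. x $ i)" for i :: "'n::finite"
proof -
  have "x $ i = (\<Sum>j\<in>UNIV. of_int (if j = i then 1 else 0) * x $ j) + of_int 0" for x :: "real ^ 'n"
    by (simp add: if_distrib[of real_of_int] if_distrib[of "\<lambda>c. c * _"] cong: if_cong)
  then show ?thesis
    unfolding int_affine_def by (intro exI[of _ "\<lambda>j. if j = i then 1 else 0"] exI[of _ 0]) blast
qed

lemma int_affine_add:
  assumes "int_affine f" "int_affine g"
  shows "int_affine (\<lambda>x. f x + g x)"
proof -
  obtain a b where f: "\<And>x. f x = (\<Sum>i\<in>UNIV. of_int (a i) * x $ i) + of_int b"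
    using assms(1) unfolding int_affine_def by blast
  obtain c d where g: "\<And>x. g x = (\<Sum>i\<in>UNIV. of_int (c i) * x $ i) + of_int d"
    using assms(2) unfolding int_affine_def by blast
  show ?thesis
    unfolding int_affine_def f g
    by (intro exI[of _ "\<lambda>i. a i + c i"] exI[of _ "b + d"])
      (simp add: algebra_simps sum.distrib)
qed

lemma int_affine_scale:
  assumes "int_affine f"
  shows "int_affine (\<lambda>x. of_int c * f x)"
proof -
  obtain a b where f: "\<And>x. f x = (\<Sum>i\<in>UNIV. of_int (a i) * x $ i) + of_int b"
    using assms(1) unfolding int_affine_def by blast
  show ?thesis
    unfolding int_affine_def f
    by (intro exI[of _ "\<lambda>i. c * a i"] exI[of _ "c * b"])
      (simp add: algebra_simps sum_distrib_left)
qed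

lemma int_affine_sum:
  assumes "finite A" "\<And>i. i \<in> A \<Longrightarrow> int_affine (f i)"
  shows "int_affine (\<lambda>x. \<Sum>i\<in>A. f i x)"
  using assms
  by (induction rule: finite_induct) (use int_affine_const[of 0] in \<open>auto intro: int_affine_add\<close>)

lemma int_affine_compose:
  assumes "int_affine f" "\<And>i. int_affine (u i)"
  shows "int_affine (\<lambda>x. f (\<chi> i. u i x))"
proof -
  obtain a b where f: "\<And>x. f x = (\<Sum>i\<in>UNIV. of_int (a i) * x $ i) + of_int b"
    using assms(1) unfolding int_affine_def by blast
  show ?thesis
    unfolding f using assms(2)
    by (auto intro!: int_affine_add int_affine_sum int_affine_scale int_affine_const)
qed

lemma int_plI:
  assumes "g \<in> extensional cube" "continuous_on cube g" "finite P"
    "\<And>f. f \<in> P \<Longrightarrow> int_affine f" "\<And>x. x \<in> cube \<Longrightarrow> \<exists>f\<in>P. g x = f x"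
  shows "g \<in> int_pl"
  using assms unfolding int_pl_def by blast

lemma int_plE:
  assumes "g \<in> int_pl"
  obtains P where "g \<in> extensional cube" "continuous_on cube g" "finite P"
    "\<And>f. f \<in> P \<Longrightarrow> int_affine f" "\<And>x. x \<in> cube \<Longrightarrow> \<exists>f\<in>P. g x = f x"
  using assms unfolding int_pl_def by blast

lemma int_pl_restrict:
  assumes "continuous_on cube g" "finite P"
    "\<And>f. f \<in> P \<Longrightarrow> int_affine f" "\<And>x. x \<in> cube \<Longrightarrow> \<exists>f\<in>P. g x = f x"
  shows "(\<lambda>x\<in>cube. g x) \<in> int_pl"
proof (rule int_plI)
  show "continuous_on cube (\<lambda>x\<in>cube. g x)"
    using assms(1) by (rule continuous_on_eq) simp
qed (use assms in auto)

lemma int_pl_const: "(\<lambda>x\<in>cube. of_int c) \<in> int_pl"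
  by (rule int_pl_restrict[of _ "{\<lambda>x. of_int c}"]) (auto intro: int_affine_const)

lemma int_pl_zero: "(\<lambda>x\<in>cube. 0) \<in> int_pl"
  using int_pl_const[of 0] by simp

lemma int_pl_one: "(\<lambda>x\<in>cube. 1) \<in> int_pl"
  using int_pl_const[of 1] by simp

lemma int_pl_coord: "coord i \<in> int_pl"
  unfolding coord_def
  by (rule int_pl_restrict[of _ "{\<lambda>x. x $ i}"])
    (auto intro: int_affine_proj continuous_intros)

lemma int_pl_add:
  assumes "f \<in> int_pl" "g \<in> int_pl"
  shows "(\<lambda>x\<in>cube. f x + g x) \<in> int_pl"
proof -
  obtain P where P: "continuous_on cube f" "finite P" "\<And>a. a \<in> P \<Longrightarrow> int_affine a"
    "\<And>x. x \<in> cube \<Longrightarrow> \<exists>a\<in>P. f x = a x" using assms(1) by (elim int_plE) blast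
  obtain Q where Q: "continuous_on cube g" "finite Q" "\<And>a. a \<in> Q \<Longrightarrow> int_affine a"
    "\<And>x. x \<in> cube \<Longrightarrow> \<exists>a\<in>Q. g x = a x" using assms(2) by (elim int_plE) blast
  show ?thesis
  proof (rule int_pl_restrict[of _ "(\<lambda>(a, b). \<lambda>x. a x + b x) ` (P \<times> Q)"])
    show "continuous_on cube (\<lambda>x. f x + g x)" using P Q by (intro continuous_intros)
    show "\<exists>a\<in>(\<lambda>(a, b). \<lambda>x. a x + b x) ` (P \<times> Q). f x + g x = a x" if "x \<in> cube" for x
      using P(4)[OF that] Q(4)[OF that] by force
  qed (use P Q in \<open>auto intro: int_affine_add\<close>)
qed

lemma int_pl_uminus:
  assumes "f \<in> int_pl"
  shows "(\<lambda>x\<in>cube. - f x) \<in> int_pl"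
proof -
  obtain P where P: "continuous_on cube f" "finite P" "\<And>a. a \<in> P \<Longrightarrow> int_affine a"
    "\<And>x. x \<in> cube \<Longrightarrow> \<exists>a\<in>P. f x = a x" using assms(1) by (elim int_plE) blast
  show ?thesis
  proof (rule int_pl_restrict[of _ "(\<lambda>a x. of_int (-1) * a x) ` P"])
    show "continuous_on cube (\<lambda>x. - f x)" using P by (intro continuous_intros)
    show "\<exists>a\<in>(\<lambda>a x. of_int (-1) * a x) ` P. - f x = a x" if "x \<in> cube" for x
      using P(4)[OF that] by force
    show "int_affine a" if "a \<in> (\<lambda>a x. of_int (-1) * a x) ` P" for a
      using that P(3) int_affine_scale by blast
  qed (use P in auto)
qed

lemma int_pl_diff:
  assumes "f \<in> int_pl" "g \<in> int_pl"
  shows "(\<lambda>x\<in>cube. f x - g x) \<in> int_pl"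
proof -
  have "(\<lambda>x\<in>cube. f x - g x) = (\<lambda>x\<in>cube. f x + (\<lambda>x\<in>cube. - g x) x)" by auto
  then show ?thesis by (simp only: int_pl_add int_pl_uminus assms)
qed

lemma int_pl_max:
  assumes "f \<in> int_pl" "g \<in> int_pl"
  shows "(\<lambda>x\<in>cube. max (f x) (g x)) \<in> int_pl"
proof -
  obtain P where P: "continuous_on cube f" "finite P" "\<And>a. a \<in> P \<Longrightarrow> int_affine a"
    "\<And>x. x \<in> cube \<Longrightarrow> \<exists>a\<in>P. f x = a x" using assms(1) by (elim int_plE) blast
  obtain Q where Q: "continuous_on cube g" "finite Q" "\<And>a. a \<in> Q \<Longrightarrow> int_affine a"
    "\<And>x. x \<in> cube \<Longrightarrow> \<exists>a\<in>Q. g x = a x" using assms(2) by (elim int_plE) blast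
  show ?thesis
  proof (rule int_pl_restrict[of _ "P \<union> Q"])
    show "continuous_on cube (\<lambda>x. max (f x) (g x))" using P Q by (intro continuous_intros)
    show "\<exists>a\<in>P \<union> Q. max (f x) (g x) = a x" if "x \<in> cube" for x
      using P(4)[OF that] Q(4)[OF that] unfolding max_def by auto
  qed (use P Q in auto)
qed

lemma int_pl_min:
  assumes "f \<in> int_pl" "g \<in> int_pl"
  shows "(\<lambda>x\<in>cube. min (f x) (g x)) \<in> int_pl"
proof -
  have "(\<lambda>x\<in>cube. min (f x) (g x)) =
      (\<lambda>x\<in>cube. - (\<lambda>x\<in>cube. max ((\<lambda>x\<in>cube. - f x) x) ((\<lambda>x\<in>cube. - g x) x)) x)"
    by (auto simp: min_def max_def)
  then show ?thesis by (simp only: int_pl_uminus int_pl_max assms)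
qed

lemma int_pl_star:
  assumes "r \<in> int_pl" "s \<in> int_pl"
  shows "(\<lambda>x\<in>cube. luk_star (r x) (s x)) \<in> int_pl"
proof -
  have "(\<lambda>x\<in>cube. luk_star (r x) (s x)) =
      (\<lambda>x\<in>cube. max ((\<lambda>x\<in>cube. (\<lambda>x\<in>cube. r x + s x) x - (\<lambda>x\<in>cube. 1) x) x) ((\<lambda>x\<in>cube. 0) x))"
    by (auto simp: luk_star_def)
  then show ?thesis by (simp only: int_pl_max int_pl_diff int_pl_add int_pl_zero int_pl_one assms)
qed

lemma int_pl_imp:
  assumes "r \<in> int_pl" "s \<in> int_pl"
  shows "(\<lambda>x\<in>cube. luk_imp (r x) (s x)) \<in> int_pl"
proof -
  have "(\<lambda>x\<in>cube. luk_imp (r x) (s x)) =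
      (\<lambda>x\<in>cube. min ((\<lambda>x\<in>cube. 1) x) ((\<lambda>x\<in>cube. (\<lambda>x\<in>cube. (\<lambda>x\<in>cube. 1) x - r x) x + s x) x))"
    by (auto simp: luk_imp_def)
  then show ?thesis by (simp only: int_pl_min int_pl_diff int_pl_add int_pl_zero int_pl_one assms)
qed

lemma free_carrier_int_pl: "r \<in> free_carrier \<Longrightarrow> r \<in> int_pl"
  by (induction rule: free_carrier.induct)
    (simp_all only: int_pl_coord int_pl_zero int_pl_one int_pl_star int_pl_imp)

lemma free_carrier_range:
  assumes "r \<in> free_carrier" "x \<in> cube"
  shows "0 \<le> r x \<and> r x \<le> 1"
  using assms
  by (induction rule: free_carrier.induct)
    (auto simp: coord_def cube_def luk_star_def luk_imp_def)

text \<open>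
  The affine pieces of a composite are indexed by a piece of the outer function together with a
  choice of one piece for every inner coordinate.
\<close>

lemma int_pl_compose:
  fixes S :: "real ^ 'n \<Rightarrow> real ^ 'm"
  assumes g: "g \<in> int_pl" and S: "S \<in> cube \<rightarrow> cube" and Si: "\<And>i. (\<lambda>x\<in>cube. S x $ i) \<in> int_pl"
  shows "compose cube g S \<in> int_pl"
proof -
  obtain P where P: "continuous_on cube g" "finite P" "\<And>a. a \<in> P \<Longrightarrow> int_affine a"
    "\<And>x. x \<in> cube \<Longrightarrow> \<exists>a\<in>P. g x = a x" using g by (elim int_plE) blast
  have "\<exists>Q. continuous_on cube (\<lambda>x\<in>cube. S x $ i) \<and> finite Q \<and> (\<forall>a\<in>Q. int_affine a) \<and>
      (\<forall>x\<in>cube. \<exists>a\<in>Q. S x $ i = a x)" for i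
    using Si[of i] by (elim int_plE) force
  then obtain Q where Q': "\<And>i. continuous_on cube (\<lambda>x\<in>cube. S x $ i) \<and> finite (Q i) \<and>
      (\<forall>a\<in>Q i. int_affine a) \<and> (\<forall>x\<in>cube. \<exists>a\<in>Q i. S x $ i = a x)"
    using choice[of "\<lambda>i Q. continuous_on cube (\<lambda>x\<in>cube. S x $ i) \<and> finite Q \<and>
      (\<forall>a\<in>Q. int_affine a) \<and> (\<forall>x\<in>cube. \<exists>a\<in>Q. S x $ i = a x)"] by blast
  then have Q: "\<And>i. continuous_on cube (\<lambda>x\<in>cube. S x $ i)" "\<And>i. finite (Q i)"
    "\<And>i a. a \<in> Q i \<Longrightarrow> int_affine a" "\<And>i x. x \<in> cube \<Longrightarrow> \<exists>a\<in>Q i. S x $ i = a x"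
    by auto
  have "continuous_on cube (\<lambda>x. S x $ i)" for i
    using Q(1)[of i] by (rule continuous_on_eq) simp
  then have contS: "continuous_on cube S"
    using continuous_on_vec_lambda[of cube "\<lambda>i x. S x $ i"] by simp
  show ?thesis
    unfolding compose_def
  proof (rule int_pl_restrict[of _ "(\<lambda>(a, u). \<lambda>x. a (\<chi> i. u i x)) ` (P \<times> (\<Pi>\<^sub>E i\<in>UNIV. Q i))"])
    show "continuous_on cube (\<lambda>x. g (S x))"
      using continuous_on_compose2[OF P(1) contS] S by auto
    show "\<exists>f\<in>(\<lambda>(a, u). \<lambda>x. a (\<chi> i. u i x)) ` (P \<times> (\<Pi>\<^sub>E i\<in>UNIV. Q i)). g (S x) = f x"
      if x: "x \<in> cube" for x
    proof -
      obtain a where a: "a \<in> P" "g (S x) = a (S x)" using P(4) S x by blast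
      obtain u where u: "\<And>i. u i \<in> Q i" "\<And>i. S x $ i = u i x" using Q(4)[OF x] by metis
      have "S x = (\<chi> i. u i x)" by (simp add: vec_eq_iff u(2))
      then have "g (S x) = (\<lambda>(a, u). \<lambda>x. a (\<chi> i. u i x)) (a, u) x" using a by simp
      moreover have "(a, u) \<in> P \<times> (\<Pi>\<^sub>E i\<in>UNIV. Q i)" using a u by auto
      ultimately show ?thesis by (metis imageI)
    qed
    show "finite ((\<lambda>(a, u). \<lambda>x. a (\<chi> i. u i x)) ` (P \<times> (\<Pi>\<^sub>E i\<in>UNIV. Q i)))"
      using P(2) Q(2) by (simp add: finite_PiE)
    show "int_affine f" if f: "f \<in> (\<lambda>(a, u). \<lambda>x. a (\<chi> i. u i x)) ` (P \<times> (\<Pi>\<^sub>E i\<in>UNIV. Q i))" for f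
    proof -
      obtain a u where au: "a \<in> P" "u \<in> (\<Pi>\<^sub>E i\<in>UNIV. Q i)" "f = (\<lambda>x. a (\<chi> i. u i x))"
        using f by (elim imageE SigmaE) simp
      have "\<And>i. int_affine (u i)" using au(2) Q(3) by (auto simp: PiE_iff)
      then show ?thesis unfolding au(3) using P(3)[OF au(1)] by (intro int_affine_compose)
    qed
  qed
qed


section \<open>Piecewise affine functions along a ray\<close>

lemma ray_tendsto: "((\<lambda>h. p + h *\<^sub>R w) \<longlongrightarrow> p) (at_right 0)" for p w :: "real ^ 'n"
  by (rule tendsto_eq_intros refl | simp)+

lemma int_pl_tendsto_on_ray:
  assumes "g \<in> int_pl" "p \<in> cube" "w \<in> tangent_cone p"
  shows "((\<lambda>h. g (p + h *\<^sub>R w)) \<longlongrightarrow> g p) (at_right 0)"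
proof (rule continuous_on_tendsto_compose[OF _ ray_tendsto assms(2)])
  show "continuous_on cube g" using assms(1) by (elim int_plE)
  show "\<forall>\<^sub>F h in at_right 0. p + h *\<^sub>R w \<in> cube" using assms(3) by (simp add: tangent_cone_def)
qed

text \<open>
  Only the affine pieces through the point \<open>(p, g p)\<close> matter near \<open>p\<close>.  Along the ray the
  difference quotient of each of them is constant, so the difference quotient of \<open>g\<close> takes finitely
  many values on a short interval; being continuous there, it is constant.
\<close>

lemma int_pl_eventually_linear_on_ray:
  assumes g: "g \<in> int_pl" and p: "p \<in> cube" and w: "w \<in> tangent_cone p"
  shows "\<exists>d. \<forall>\<^sub>F h in at_right 0. g (p + h *\<^sub>R w) = g p + h * d"
proof -
  obtain P where P: "continuous_on cube g" "finite P" "\<And>a. a \<in> P \<Longrightarrow> int_affine a"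
    "\<And>x. x \<in> cube \<Longrightarrow> \<exists>a\<in>P. g x = a x" using g by (elim int_plE) blast
  have in_cube: "\<forall>\<^sub>F h in at_right 0. p + h *\<^sub>R w \<in> cube"
    using w by (simp add: tangent_cone_def)
  have g_lim: "((\<lambda>h. g (p + h *\<^sub>R w)) \<longlongrightarrow> g p) (at_right 0)"
    by (rule int_pl_tendsto_on_ray[OF g p w])
  have affine: "f (p + h *\<^sub>R w) = f p + h * (f w - f 0)" if f: "f \<in> P" for f h
  proof -
    obtain a b where "\<And>x. f x = (\<Sum>i\<in>UNIV. of_int (a i) * x $ i) + of_int b"
      using P(3)[OF f] unfolding int_affine_def by blast
    then show ?thesis by (simp add: algebra_simps sum.distrib sum_distrib_left)
  qed
  have "\<forall>\<^sub>F h in at_right 0. f p \<noteq> g p \<longrightarrow> g (p + h *\<^sub>R w) \<noteq> f (p + h *\<^sub>R w)" if f: "f \<in> P" for f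
  proof (cases "f p = g p")
    case False
    have "((\<lambda>h. f p + h * (f w - f 0)) \<longlongrightarrow> f p + 0 * (f w - f 0)) (at_right 0)"
      by (intro tendsto_intros)
    then have "((\<lambda>h. g (p + h *\<^sub>R w) - f (p + h *\<^sub>R w)) \<longlongrightarrow> g p - f p) (at_right 0)"
      using g_lim by (auto simp: affine[OF f] intro: tendsto_diff)
    then have "\<forall>\<^sub>F h in at_right 0. g (p + h *\<^sub>R w) - f (p + h *\<^sub>R w) \<noteq> 0"
      using False by (intro tendsto_imp_eventually_ne) auto
    then show ?thesis by (rule eventually_mono) simp
  qed simp
  then have "\<forall>\<^sub>F h in at_right 0. \<forall>f\<in>P. f p \<noteq> g p \<longrightarrow> g (p + h *\<^sub>R w) \<noteq> f (p + h *\<^sub>R w)"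
    using P(2) by (simp add: eventually_ball_finite_distrib)
  with in_cube obtain \<delta> where \<delta>: "\<delta> > 0"
    "\<And>h. 0 < h \<Longrightarrow> h < \<delta> \<Longrightarrow> p + h *\<^sub>R w \<in> cube"
    "\<And>h f. 0 < h \<Longrightarrow> h < \<delta> \<Longrightarrow> f \<in> P \<Longrightarrow> g (p + h *\<^sub>R w) = f (p + h *\<^sub>R w) \<Longrightarrow> f p = g p"
    unfolding eventually_at_right_field by (metis min_less_iff_conj)
  define quot where "quot h = (g (p + h *\<^sub>R w) - g p) / h" for h
  have "quot ` {0<..<\<delta>} \<subseteq> (\<lambda>f. f w - f 0) ` P"
  proof
    fix y assume "y \<in> quot ` {0<..<\<delta>}"
    then obtain h where h: "0 < h" "h < \<delta>" "y = quot h" by auto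
    obtain f where f: "f \<in> P" "g (p + h *\<^sub>R w) = f (p + h *\<^sub>R w)" using P(4) \<delta>(2) h by blast
    then have "y = f w - f 0"
      using \<delta>(3)[OF h(1,2) f] h by (simp add: affine[OF f(1)] quot_def)
    then show "y \<in> (\<lambda>f. f w - f 0) ` P" using f by blast
  qed
  then have "finite (quot ` {0<..<\<delta>})" using P(2) by (meson finite_imageI finite_subset)
  moreover have "continuous_on {0<..<\<delta>} quot"
  proof -
    have "continuous_on {0<..<\<delta>} (\<lambda>h. g (p + h *\<^sub>R w))"
      using \<delta>(2) by (intro continuous_on_compose2[OF P(1)] continuous_intros) auto
    then show ?thesis unfolding quot_def by (intro continuous_intros) auto
  qed
  ultimately obtain d where d: "\<And>h. h \<in> {0<..<\<delta>} \<Longrightarrow> quot h = d"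
    using continuous_finite_range_constant[of "{0<..<\<delta>}" quot] unfolding constant_on_def by auto
  have "g (p + h *\<^sub>R w) = g p + h * d" if "0 < h" "h < \<delta>" for h
    using d[of h] that by (auto simp: quot_def field_simps)
  then show ?thesis using \<delta>(1) unfolding eventually_at_right_field by blast
qed


section \<open>Prime filters of MV-algebras\<close>

lemma mv_algebraD:
  assumes "mv_algebra A"
  shows "mvzero A \<in> carrier A" "mvone A \<in> carrier A"
    "\<And>a b. a \<in> carrier A \<Longrightarrow> b \<in> carrier A \<Longrightarrow> mvstar A a b \<in> carrier A"
    "\<And>a b. a \<in> carrier A \<Longrightarrow> b \<in> carrier A \<Longrightarrow> mvimp A a b \<in> carrier A"
    "\<And>s t. mv_valid unit_mv s t \<Longrightarrow> mv_valid A s t"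
  using assms unfolding mv_algebra_def by blast+

lemma mv_homD:
  assumes "h \<in> mv_hom A B"
  shows "h (mvzero A) = mvzero B" "h (mvone A) = mvone B"
    "\<And>a. a \<in> carrier A \<Longrightarrow> h a \<in> carrier B"
    "\<And>a b. a \<in> carrier A \<Longrightarrow> b \<in> carrier A \<Longrightarrow> h (mvstar A a b) = mvstar B (h a) (h b)"
    "\<And>a b. a \<in> carrier A \<Longrightarrow> b \<in> carrier A \<Longrightarrow> h (mvimp A a b) = mvimp B (h a) (h b)"
  using assms unfolding mv_hom_def by auto

lemma mv_eval_hom:
  assumes A: "mv_algebra A" and h: "h \<in> mv_hom A B" and e: "e \<in> UNIV \<rightarrow> carrier A"
  shows "mv_eval A e t \<in> carrier A \<and> h (mv_eval A e t) = mv_eval B (h \<circ> e) t"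
proof (induction t)
  case (MVar i)
  show ?case using e by auto
qed (simp_all add: mv_algebraD(1-4)[OF A] mv_homD[OF h])

text \<open>Identities pass to homomorphic images: lift the assignment of the variables.\<close>

lemma mv_algebra_onto_image:
  assumes A: "mv_algebra A" and h: "h \<in> mv_hom A B" and onto: "h ` carrier A = carrier B"
  shows "mv_algebra B"
proof -
  have "mv_eval B e s = mv_eval B e t" if st: "mv_valid A s t" and e: "e \<in> UNIV \<rightarrow> carrier B" for s t e
  proof -
    define e' where "e' i = (SOME a. a \<in> carrier A \<and> h a = e i)" for i
    have e': "e' i \<in> carrier A \<and> h (e' i) = e i" for i
    proof -
      have "e i \<in> h ` carrier A" using e onto by auto
      then show ?thesis unfolding e'_def by - (rule someI_ex, auto)
    qed
    then have he': "h \<circ> e' = e" and "e' \<in> UNIV \<rightarrow> carrier A" by auto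
    then have "mv_eval A e' s = mv_eval A e' t" using st unfolding mv_valid_def by blast
    then show ?thesis
      using mv_eval_hom[OF A h \<open>e' \<in> _\<close>] he' by metis
  qed
  moreover have "mvzero B \<in> carrier B" "mvone B \<in> carrier B"
    using mv_algebraD(1,2)[OF A] mv_homD(1-3)[OF h] by metis+
  moreover have "mvstar B a b \<in> carrier B \<and> mvimp B a b \<in> carrier B"
    if "a \<in> carrier B" "b \<in> carrier B" for a b
  proof -
    have "a \<in> h ` carrier A" "b \<in> h ` carrier A" using that by (simp_all only: onto)
    then obtain a' b' where ab: "a' \<in> carrier A" "a = h a'" "b' \<in> carrier A" "b = h b'"
      by (elim imageE)
    have "mvstar B a b = h (mvstar A a' b')" "mvimp B a b = h (mvimp A a' b')"
      unfolding ab(2,4) using mv_homD(4,5)[OF h ab(1,3)] by simp_all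
    then show ?thesis
      using mv_homD(3)[OF h] mv_algebraD(3,4)[OF A ab(1,3)] by simp
  qed
  moreover have "mv_valid B s t" if "mv_valid unit_mv s t" for s t
    unfolding mv_valid_def using calculation(1)[OF mv_algebraD(5)[OF A that]] by blast
  ultimately show ?thesis unfolding mv_algebra_def by blast
qed

text \<open>
  A congruence with totally ordered nontrivial quotient has a prime filter as the class of \<open>1\<close>;
  the quotient algebra is carried by the equivalence classes.
\<close>

lemma prime_mv_filter_of_congruence:
  fixes A :: "'a mv_alg"
  assumes A: "mv_algebra A" and R: "equiv (carrier A) R"
    and cong: "\<And>a a' b b'. (a, a') \<in> R \<Longrightarrow> (b, b') \<in> R \<Longrightarrow>
      (mvstar A a b, mvstar A a' b') \<in> R \<and> (mvimp A a b, mvimp A a' b') \<in> R"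
    and nontriv: "(mvzero A, mvone A) \<notin> R"
    and chain: "\<And>a b. a \<in> carrier A \<Longrightarrow> b \<in> carrier A \<Longrightarrow>
      (mvimp A a b, mvone A) \<in> R \<or> (mvimp A b a, mvone A) \<in> R"
  shows "prime_mv_filter A {a \<in> carrier A. (a, mvone A) \<in> R}"
proof -
  define cls where "cls a = R `` {a}" for a
  define B where "B = \<lparr>carrier = cls ` carrier A,
    mvstar = (\<lambda>X Y. \<Union>a\<in>X. \<Union>b\<in>Y. cls (mvstar A a b)),
    mvimp = (\<lambda>X Y. \<Union>a\<in>X. \<Union>b\<in>Y. cls (mvimp A a b)),
    mvzero = cls (mvzero A), mvone = cls (mvone A)\<rparr>"
  have closed: "mvzero A \<in> carrier A" "mvone A \<in> carrier A"
    "\<And>a b. a \<in> carrier A \<Longrightarrow> b \<in> carrier A \<Longrightarrow> mvstar A a b \<in> carrier A \<and> mvimp A a b \<in> carrier A"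
    using mv_algebraD(1-4)[OF A] by auto
  have cls_eq: "cls a = cls b \<longleftrightarrow> (a, b) \<in> R" if "a \<in> carrier A" "b \<in> carrier A" for a b
    using eq_equiv_class_iff[OF R that] by (simp add: cls_def)
  have "congruent2 R R (\<lambda>a b. cls (mvstar A a b))" "congruent2 R R (\<lambda>a b. cls (mvimp A a b))"
    unfolding cls_def by (auto intro!: congruent2I' equiv_class_eq[OF R] dest: cong)
  then have ops: "mvstar B (cls a) (cls b) = cls (mvstar A a b)"
    "mvimp B (cls a) (cls b) = cls (mvimp A a b)" if "a \<in> carrier A" "b \<in> carrier A" for a b
    using UN_equiv_class2[OF R R _ that] by (simp_all add: B_def cls_def)
  have hom: "cls \<in> mv_hom A B"
    using closed ops by (auto simp: mv_hom_def B_def)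
  have onto: "cls ` carrier A = carrier B" by (simp add: B_def)
  have "mv_nontrivial_chain B"
    unfolding mv_nontrivial_chain_def
  proof (intro conjI ballI)
    show "mvzero B \<noteq> mvone B" using nontriv closed by (simp add: B_def cls_eq)
    fix X Y assume "X \<in> carrier B" "Y \<in> carrier B"
    then have "X \<in> cls ` carrier A" "Y \<in> cls ` carrier A" by (simp_all only: onto)
    then obtain a b where ab: "a \<in> carrier A" "X = cls a" "b \<in> carrier A" "Y = cls b"
      by (elim imageE)
    have "mvone B = cls (mvone A)" by (simp add: B_def)
    then have "mvimp B X Y = mvone B \<longleftrightarrow> (mvimp A a b, mvone A) \<in> R"
      "mvimp B Y X = mvone B \<longleftrightarrow> (mvimp A b a, mvone A) \<in> R"
      unfolding ab(2,4) using closed(2) closed(3)[OF ab(1,3)] closed(3)[OF ab(3,1)]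
      by (simp_all only: ops[OF ab(1,3)] ops[OF ab(3,1)] cls_eq)
    then show "mvimp B X Y = mvone B \<or> mvimp B Y X = mvone B"
      using chain[OF ab(1,3)] by blast
  qed
  moreover have "{a \<in> carrier A. (a, mvone A) \<in> R} = mv_kernel A B cls"
    using closed by (simp add: mv_kernel_def B_def cls_eq cong: conj_cong)
  ultimately show ?thesis
    using mv_algebra_onto_image[OF A hom onto] hom onto unfolding prime_mv_filter_def by blast
qed

text \<open>
  Pulling back the kernel congruence of the quotient by \<open>Q\<close> along \<open>\<sigma>\<close> embeds the new quotient into
  the old one, and subalgebras of nontrivial chains are nontrivial chains.
\<close>

lemma prime_mv_filter_preimage:
  fixes A :: "'a mv_alg"
  assumes A: "mv_algebra A" and \<sigma>: "\<sigma> \<in> mv_hom A A" and Q: "prime_mv_filter A Q"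
  shows "prime_mv_filter A {a \<in> carrier A. \<sigma> a \<in> Q}"
proof -
  obtain B :: "'a set mv_alg" and h where B: "h \<in> mv_hom A B" "Q = mv_kernel A B h" "mv_nontrivial_chain B"
    using Q unfolding prime_mv_filter_def by blast
  define R where "R = {(a, b). a \<in> carrier A \<and> b \<in> carrier A \<and> h (\<sigma> a) = h (\<sigma> b)}"
  have closed: "mvzero A \<in> carrier A" "mvone A \<in> carrier A"
    "\<And>a b. a \<in> carrier A \<Longrightarrow> b \<in> carrier A \<Longrightarrow> mvstar A a b \<in> carrier A \<and> mvimp A a b \<in> carrier A"
    using mv_algebraD(1-4)[OF A] by auto
  have \<sigma>': "\<And>a. a \<in> carrier A \<Longrightarrow> \<sigma> a \<in> carrier A" "\<sigma> (mvzero A) = mvzero A" "\<sigma> (mvone A) = mvone A"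
    "\<And>a b. a \<in> carrier A \<Longrightarrow> b \<in> carrier A \<Longrightarrow>
       \<sigma> (mvstar A a b) = mvstar A (\<sigma> a) (\<sigma> b) \<and> \<sigma> (mvimp A a b) = mvimp A (\<sigma> a) (\<sigma> b)"
    using mv_homD[OF \<sigma>] by auto
  have h': "\<And>a. a \<in> carrier A \<Longrightarrow> h a \<in> carrier B" "h (mvzero A) = mvzero B" "h (mvone A) = mvone B"
    "\<And>a b. a \<in> carrier A \<Longrightarrow> b \<in> carrier A \<Longrightarrow>
       h (mvstar A a b) = mvstar B (h a) (h b) \<and> h (mvimp A a b) = mvimp B (h a) (h b)"
    using mv_homD[OF B(1)] by auto
  have "prime_mv_filter A {a \<in> carrier A. (a, mvone A) \<in> R}"
  proof (rule prime_mv_filter_of_congruence[OF A])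
    show "equiv (carrier A) R"
      by (auto simp: R_def equiv_def refl_on_def sym_def trans_def)
    show "(mvzero A, mvone A) \<notin> R"
      using B(3) closed by (auto simp: R_def \<sigma>' h' mv_nontrivial_chain_def)
    show "(mvimp A a b, mvone A) \<in> R \<or> (mvimp A b a, mvone A) \<in> R"
      if "a \<in> carrier A" "b \<in> carrier A" for a b
      using that B(3) closed by (simp add: R_def \<sigma>' h' mv_nontrivial_chain_def)
  qed (use closed in \<open>auto simp: R_def \<sigma>' h'\<close>)
  moreover have "{a \<in> carrier A. (a, mvone A) \<in> R} = {a \<in> carrier A. \<sigma> a \<in> Q}"
    using closed by (auto simp: R_def B(2) mv_kernel_def \<sigma>' h')
  ultimately show ?thesis by simp
qed

lemma prime_mv_filter_closed:
  fixes A :: "'a mv_alg"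
  assumes A: "mv_algebra A" and Q: "prime_mv_filter A Q"
  shows "mvone A \<in> Q" and "\<And>a b. a \<in> Q \<Longrightarrow> b \<in> Q \<Longrightarrow> mvstar A a b \<in> Q"
proof -
  obtain B :: "'a set mv_alg" and h where B: "mv_algebra B" "h \<in> mv_hom A B" "Q = mv_kernel A B h"
    using Q unfolding prime_mv_filter_def by blast
  show "mvone A \<in> Q" using mv_algebraD(2)[OF A] mv_homD(2)[OF B(2)] B(3) by (simp add: mv_kernel_def)
  \<comment> \<open>\<open>1 \<star> 1 = 1\<close> is an identity of \<open>[0,1]\<close>, hence holds in \<open>B\<close>\<close>
  have "mv_valid unit_mv (MStar MOne MOne) MOne"
    by (simp add: mv_valid_def unit_mv_def luk_star_def)
  then have "mv_valid B (MStar MOne MOne) MOne" by (rule mv_algebraD(5)[OF B(1)])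
  moreover have "(\<lambda>_. mvone B) \<in> (UNIV :: nat set) \<rightarrow> carrier B"
    using mv_algebraD(2)[OF B(1)] by auto
  ultimately have "mv_eval B (\<lambda>_. mvone B) (MStar MOne MOne) = mv_eval B (\<lambda>_. mvone B) MOne"
    unfolding mv_valid_def by (rule bspec)
  then have one: "mvstar B (mvone B) (mvone B) = mvone B" by simp
  show "mvstar A a b \<in> Q" if "a \<in> Q" "b \<in> Q" for a b
    using that mv_algebraD(3)[OF A] mv_homD(4)[OF B(2)] one B(3) by (simp add: mv_kernel_def)
qed


section \<open>The free MV-algebra and its germinal filters\<close>

lemma free_mv_sel [simp]:
  "carrier free_mv = free_carrier"
  "mvstar free_mv = (\<lambda>r s. \<lambda>x\<in>cube. luk_star (r x) (s x))"
  "mvimp free_mv = (\<lambda>r s. \<lambda>x\<in>cube. luk_imp (r x) (s x))"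
  "mvzero free_mv = (\<lambda>x\<in>cube. 0)"
  "mvone free_mv = (\<lambda>x\<in>cube. 1)"
  by (simp_all add: free_mv_def)

lemma free_carrier_extensional: "r \<in> free_carrier \<Longrightarrow> r \<in> extensional cube"
  using free_carrier_int_pl unfolding int_pl_def by blast

text \<open>Terms are evaluated pointwise, so the free algebra inherits the identities of \<open>[0,1]\<close>.\<close>

lemma mv_eval_free_mv:
  assumes "e \<in> UNIV \<rightarrow> free_carrier"
  shows "mv_eval free_mv e t = (\<lambda>x\<in>cube. mv_eval unit_mv (\<lambda>i. e i x) t)"
proof (induction t)
  case (MVar i)
  have "e i \<in> extensional cube" using assms free_carrier_extensional by auto
  then show ?case using extensional_restrict[of "e i" cube] by (simp add: eta_contract_eq)
qed (auto simp: unit_mv_def)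

lemma mv_algebra_free_mv: "mv_algebra (free_mv :: (real ^ 'n \<Rightarrow> real) mv_alg)"
proof -
  have "mv_valid (free_mv :: (real ^ 'n \<Rightarrow> real) mv_alg) s t" if st: "mv_valid unit_mv s t" for s t
    unfolding mv_valid_def
  proof
    fix e :: "nat \<Rightarrow> real ^ 'n \<Rightarrow> real" assume "e \<in> UNIV \<rightarrow> carrier free_mv"
    then have e: "e \<in> UNIV \<rightarrow> free_carrier" by simp
    have "mv_eval unit_mv (\<lambda>i. e i x) s = mv_eval unit_mv (\<lambda>i. e i x) t" if x: "x \<in> cube" for x
    proof -
      have "(\<lambda>i. e i x) \<in> UNIV \<rightarrow> carrier unit_mv"
      proof
        fix i
        have "e i \<in> free_carrier" using e by auto
        then show "e i x \<in> carrier unit_mv"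
          using free_carrier_range[OF _ x] by (simp add: unit_mv_def)
      qed
      then show ?thesis using st unfolding mv_valid_def by blast
    qed
    then show "mv_eval free_mv e s = mv_eval free_mv e t"
      unfolding mv_eval_free_mv[OF e] by auto
  qed
  then show ?thesis
    unfolding mv_algebra_def by (simp add: free_carrier.intros)
qed

definition ray_filter :: "real ^ 'n \<Rightarrow> real ^ 'n \<Rightarrow> (real ^ 'n \<Rightarrow> real) set" where
  "ray_filter p w = {r \<in> free_carrier. \<forall>\<^sub>F h in at_right 0. r (p + h *\<^sub>R w) = 1}"

lemma eventually_linear_comparable:
  fixes a b c d :: real
  shows "(\<forall>\<^sub>F h in at_right 0. a + h * c \<le> b + h * d) \<or>
    (\<forall>\<^sub>F h in at_right 0. b + h * d \<le> a + h * c)"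
proof -
  have less: "\<forall>\<^sub>F h in at_right 0. a + h * c \<le> b + h * d" if "a < b" for a b c d :: real
  proof -
    have "((\<lambda>h. b + h * d - (a + h * c)) \<longlongrightarrow> b + 0 * d - (a + 0 * c)) (at_right 0)"
      by (intro tendsto_intros)
    then have "\<forall>\<^sub>F h in at_right 0. 0 < b + h * d - (a + h * c)"
      by (rule order_tendstoD) (use that in simp)
    then show ?thesis by (rule eventually_mono) simp
  qed
  have eq: "\<forall>\<^sub>F h in at_right 0. a + h * c \<le> a + h * d" if "c \<le> d" for a c d :: real
    using eventually_at_right_less[of 0] by (rule eventually_mono) (use that in \<open>simp add: mult_left_mono\<close>)
  consider "a < b" | "b < a" | "a = b" "c \<le> d" | "a = b" "d \<le> c" by linarith
  then show ?thesis by cases (use less eq in blast)+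
qed

text \<open>
  Germs at \<open>0+\<close> of McNaughton functions restricted to a ray are germs of affine functions of one
  variable, hence totally ordered.
\<close>

lemma prime_ray_filter:
  assumes p: "p \<in> cube" and w: "w \<in> tangent_cone p"
  shows "prime_mv_filter free_mv (ray_filter p w)"
proof -
  define R where "R = {(r, s). r \<in> free_carrier \<and> s \<in> free_carrier \<and>
    (\<forall>\<^sub>F h in at_right 0. r (p + h *\<^sub>R w) = s (p + h *\<^sub>R w))}"
  have in_cube: "\<forall>\<^sub>F h in at_right 0. p + h *\<^sub>R w \<in> cube"
    using w by (simp add: tangent_cone_def)
  have "prime_mv_filter free_mv {r \<in> carrier free_mv. (r, mvone free_mv) \<in> R}"
  proof (rule prime_mv_filter_of_congruence[OF mv_algebra_free_mv])
    show "equiv (carrier free_mv) R"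
    proof (rule equivI)
      show "trans R"
        unfolding trans_def R_def by (auto elim: eventually_elim2)
    qed (auto simp: R_def refl_on_def sym_def eq_commute)
    show "(mvstar free_mv a b, mvstar free_mv a' b') \<in> R \<and> (mvimp free_mv a b, mvimp free_mv a' b') \<in> R"
      if "(a, a') \<in> R" "(b, b') \<in> R" for a a' b b'
    proof -
      have "\<forall>\<^sub>F h in at_right 0. a (p + h *\<^sub>R w) = a' (p + h *\<^sub>R w)"
        "\<forall>\<^sub>F h in at_right 0. b (p + h *\<^sub>R w) = b' (p + h *\<^sub>R w)"
        using that by (auto simp: R_def)
      then have "\<forall>\<^sub>F h in at_right 0.
          mvstar free_mv a b (p + h *\<^sub>R w) = mvstar free_mv a' b' (p + h *\<^sub>R w)"
        "\<forall>\<^sub>F h in at_right 0.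
          mvimp free_mv a b (p + h *\<^sub>R w) = mvimp free_mv a' b' (p + h *\<^sub>R w)"
        by (eventually_elim, simp add: restrict_def)+
      then show ?thesis using that by (auto simp: R_def intro: free_carrier.intros)
    qed
    show "(mvzero free_mv, mvone free_mv) \<notin> R"
    proof
      assume "(mvzero free_mv, mvone free_mv) \<in> R"
      then have "\<forall>\<^sub>F h in at_right 0.
          mvzero free_mv (p + h *\<^sub>R w) = mvone free_mv (p + h *\<^sub>R w)"
        unfolding R_def by blast
      with in_cube have "\<forall>\<^sub>F h in at_right (0::real). False"
        by eventually_elim simp
      then show False by simp
    qed
    show "(mvimp free_mv r s, mvone free_mv) \<in> R \<or> (mvimp free_mv s r, mvone free_mv) \<in> R"
      if "r \<in> carrier free_mv" "s \<in> carrier free_mv" for r s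
    proof -
      have rs: "r \<in> free_carrier" "s \<in> free_carrier" using that by simp_all
      obtain c where c: "\<forall>\<^sub>F h in at_right 0. r (p + h *\<^sub>R w) = r p + h * c"
        using int_pl_eventually_linear_on_ray[OF free_carrier_int_pl[OF rs(1)] p w] by blast
      obtain d where d: "\<forall>\<^sub>F h in at_right 0. s (p + h *\<^sub>R w) = s p + h * d"
        using int_pl_eventually_linear_on_ray[OF free_carrier_int_pl[OF rs(2)] p w] by blast
      have "(mvimp free_mv f g, mvone free_mv) \<in> R"
        if "f \<in> free_carrier" "g \<in> free_carrier"
          "\<forall>\<^sub>F h in at_right 0. f (p + h *\<^sub>R w) \<le> g (p + h *\<^sub>R w)" for f g
      proof -
        from that(3) in_cube have "\<forall>\<^sub>F h in at_right 0.
            mvimp free_mv f g (p + h *\<^sub>R w) = mvone free_mv (p + h *\<^sub>R w)"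
          by eventually_elim (simp add: luk_imp_def)
        then show ?thesis using that(1,2) by (auto simp: R_def intro: free_carrier.intros)
      qed
      moreover have "(\<forall>\<^sub>F h in at_right 0. r (p + h *\<^sub>R w) \<le> s (p + h *\<^sub>R w)) \<or>
          (\<forall>\<^sub>F h in at_right 0. s (p + h *\<^sub>R w) \<le> r (p + h *\<^sub>R w))"
        using eventually_linear_comparable[of "r p" c "s p" d]
      proof
        assume "\<forall>\<^sub>F h in at_right 0. r p + h * c \<le> s p + h * d"
        with c d have "\<forall>\<^sub>F h in at_right 0. r (p + h *\<^sub>R w) \<le> s (p + h *\<^sub>R w)"
          by eventually_elim simp
        then show ?thesis ..
      next
        assume "\<forall>\<^sub>F h in at_right 0. s p + h * d \<le> r p + h * c"
        with c d have "\<forall>\<^sub>F h in at_right 0. s (p + h *\<^sub>R w) \<le> r (p + h *\<^sub>R w)"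
          by eventually_elim simp
        then show ?thesis ..
      qed
      ultimately show ?thesis using rs by blast
    qed
  qed
  moreover have "{r \<in> carrier free_mv. (r, mvone free_mv) \<in> R} = ray_filter p w"
  proof -
    have "(r, mvone free_mv) \<in> R \<longleftrightarrow> (\<forall>\<^sub>F h in at_right 0. r (p + h *\<^sub>R w) = 1)"
      if "r \<in> free_carrier" for r
    proof -
      have "(r, mvone free_mv) \<in> R \<longleftrightarrow>
          (\<forall>\<^sub>F h in at_right 0. r (p + h *\<^sub>R w) = mvone free_mv (p + h *\<^sub>R w))"
        using that by (auto simp: R_def intro: free_carrier.intros)
      also have "\<dots> \<longleftrightarrow> (\<forall>\<^sub>F h in at_right 0. r (p + h *\<^sub>R w) = 1)"
        by (rule eventually_cong[OF in_cube]) simp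
      finally show ?thesis .
    qed
    then show ?thesis by (auto simp: ray_filter_def)
  qed
  ultimately show ?thesis by simp
qed

lemma zero_in_tangent_cone: "p \<in> cube \<Longrightarrow> 0 \<in> tangent_cone p"
  by (simp add: tangent_cone_def)

lemma ray_filter_subset_point_filter:
  assumes p: "p \<in> cube" and w: "w \<in> tangent_cone p"
  shows "ray_filter p w \<subseteq> point_filter p"
proof
  fix r assume "r \<in> ray_filter p w"
  then have r: "r \<in> free_carrier" "\<forall>\<^sub>F h in at_right 0. r (p + h *\<^sub>R w) = 1"
    by (auto simp: ray_filter_def)
  have "((\<lambda>h. r (p + h *\<^sub>R w)) \<longlongrightarrow> 1) (at_right 0)"
    using tendsto_eventually[OF r(2)] .
  moreover have "((\<lambda>h. r (p + h *\<^sub>R w)) \<longlongrightarrow> r p) (at_right 0)"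
    by (rule int_pl_tendsto_on_ray[OF free_carrier_int_pl[OF r(1)] p w])
  ultimately have "r p = 1"
    using tendsto_unique[OF trivial_limit_at_right_real] by blast
  then show "r \<in> point_filter p" using r by (simp add: point_filter_def)
qed

text \<open>
  One prime filter below \<open>\<pi>(p)\<close> for every tangent direction: this is how membership in the
  germinal filter is used in everything that concerns derivatives.
\<close>

lemma germinal_filter_subset_ray_filter:
  assumes "p \<in> cube" "w \<in> tangent_cone p"
  shows "germinal_filter free_mv (point_filter p) \<subseteq> ray_filter p w"
  unfolding germinal_filter_def
  using prime_ray_filter[OF assms] ray_filter_subset_point_filter[OF assms] by blast

text \<open>
  The part of the notion of a filter on which the passage from filters to ideals depends; point
  filters and germinal filters both have it.
\<close>

definition star_closed :: "(real ^ 'n \<Rightarrow> real) set \<Rightarrow> bool" where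
  "star_closed F \<longleftrightarrow> F \<subseteq> free_carrier \<and> (\<lambda>x\<in>cube. 1) \<in> F \<and>
    (\<forall>r\<in>F. \<forall>s\<in>F. (\<lambda>x\<in>cube. luk_star (r x) (s x)) \<in> F)"

lemma star_closed_point_filter:
  assumes "p \<in> cube"
  shows "star_closed (point_filter p)"
  unfolding star_closed_def
proof (intro conjI ballI)
  show "point_filter p \<subseteq> free_carrier" by (auto simp: point_filter_def)
  show "(\<lambda>x\<in>cube. 1) \<in> point_filter p"
    using assms free_carrier.one by (simp add: point_filter_def)
  show "(\<lambda>x\<in>cube. luk_star (r x) (s x)) \<in> point_filter p"
    if "r \<in> point_filter p" "s \<in> point_filter p" for r s
    using that assms free_carrier.star[of r s] by (simp add: point_filter_def luk_star_def)
qed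

lemma star_closed_germinal_filter:
  assumes p: "p \<in> cube"
  shows "star_closed (germinal_filter free_mv (point_filter p))"
proof -
  have "germinal_filter free_mv (point_filter p) \<subseteq> free_carrier"
    using germinal_filter_subset_ray_filter[OF p zero_in_tangent_cone[OF p]]
    by (auto simp: ray_filter_def)
  moreover have "(\<lambda>x\<in>cube. 1) \<in> Q"
    "\<And>r s. r \<in> Q \<Longrightarrow> s \<in> Q \<Longrightarrow> (\<lambda>x\<in>cube. luk_star (r x) (s x)) \<in> Q"
    if "prime_mv_filter free_mv Q" for Q
    using prime_mv_filter_closed[OF mv_algebra_free_mv that] by simp_all
  ultimately show ?thesis
    unfolding star_closed_def germinal_filter_def
    by (intro conjI ballI InterI) (blast+)
qed


section \<open>The \<open>\<ell>\<close>-group of germs\<close>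

lemma filter_ideal_int_pl: "g \<in> filter_ideal F \<Longrightarrow> g \<in> int_pl"
  by (simp add: filter_ideal_def)

lemma filter_ideal_point_filter_zero:
  assumes "p \<in> cube" "g \<in> filter_ideal (point_filter p)"
  shows "g p = 0"
proof -
  obtain r k where "r \<in> point_filter p" "\<bar>g p\<bar> \<le> of_nat k * (1 - r p)"
    using assms unfolding filter_ideal_def by blast
  then show ?thesis by (simp add: point_filter_def)
qed

lemma filter_ideal_zero:
  assumes "star_closed F"
  shows "(\<lambda>x\<in>cube. 0) \<in> filter_ideal F"
proof -
  have "\<forall>x\<in>cube. \<bar>(\<lambda>x\<in>cube. 0 :: real) x\<bar> \<le> of_nat 0 * (1 - r x)" for r :: "real ^ 'n \<Rightarrow> real"
    by simp
  then show ?thesis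
    using assms int_pl_zero unfolding filter_ideal_def star_closed_def by blast
qed

text \<open>
  Since \<open>1 - r \<star> s\<close> dominates both \<open>1 - r\<close> and \<open>1 - s\<close>, the bounds witnessing membership of two
  functions can be replaced by a common one.  Sums, negatives, joins and meets are all instances
  of the resulting convexity property.
\<close>

lemma filter_ideal_convex:
  assumes F: "star_closed F" and a: "a \<in> filter_ideal F" and b: "b \<in> filter_ideal F"
    and g: "g \<in> int_pl" and le: "\<And>x. x \<in> cube \<Longrightarrow> \<bar>g x\<bar> \<le> \<bar>a x\<bar> + \<bar>b x\<bar>"
  shows "g \<in> filter_ideal F"
proof -
  obtain r k where r: "r \<in> F" "\<And>x. x \<in> cube \<Longrightarrow> \<bar>a x\<bar> \<le> of_nat k * (1 - r x)"
    using a unfolding filter_ideal_def by blast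
  obtain s l where s: "s \<in> F" "\<And>x. x \<in> cube \<Longrightarrow> \<bar>b x\<bar> \<le> of_nat l * (1 - s x)"
    using b unfolding filter_ideal_def by blast
  define t where "t = (\<lambda>x\<in>cube. luk_star (r x) (s x))"
  have "\<bar>g x\<bar> \<le> of_nat (k + l) * (1 - t x)" if x: "x \<in> cube" for x
  proof -
    have "0 \<le> r x \<and> r x \<le> 1" "0 \<le> s x \<and> s x \<le> 1"
      using free_carrier_range[OF _ x] r(1) s(1) F unfolding star_closed_def by blast+
    then have "1 - r x \<le> 1 - t x" "1 - s x \<le> 1 - t x"
      using x by (auto simp: t_def luk_star_def)
    then have "of_nat k * (1 - r x) \<le> of_nat k * (1 - t x)"
      "of_nat l * (1 - s x) \<le> of_nat l * (1 - t x)"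
      by (simp_all add: mult_left_mono)
    then show ?thesis using le[OF x] r(2)[OF x] s(2)[OF x] by (simp add: distrib_right)
  qed
  moreover have "t \<in> F" using F r(1) s(1) unfolding star_closed_def t_def by blast
  ultimately show ?thesis unfolding filter_ideal_def using g by blast
qed

lemma filter_ideal_closed:
  assumes F: "star_closed F" and a: "a \<in> filter_ideal F" and b: "b \<in> filter_ideal F"
  shows "(\<lambda>x\<in>cube. a x + b x) \<in> filter_ideal F"
    "(\<lambda>x\<in>cube. max (a x) (b x)) \<in> filter_ideal F"
    "(\<lambda>x\<in>cube. min (a x) (b x)) \<in> filter_ideal F"
    "(\<lambda>x\<in>cube. - a x) \<in> filter_ideal F"
proof -
  note int = filter_ideal_int_pl[OF a] filter_ideal_int_pl[OF b]
  show "(\<lambda>x\<in>cube. a x + b x) \<in> filter_ideal F"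
    by (rule filter_ideal_convex[OF F a b int_pl_add[OF int]]) simp
  show "(\<lambda>x\<in>cube. max (a x) (b x)) \<in> filter_ideal F"
    by (rule filter_ideal_convex[OF F a b int_pl_max[OF int]]) (simp add: max_def)
  show "(\<lambda>x\<in>cube. min (a x) (b x)) \<in> filter_ideal F"
    by (rule filter_ideal_convex[OF F a b int_pl_min[OF int]]) (simp add: min_def)
  show "(\<lambda>x\<in>cube. - a x) \<in> filter_ideal F"
    by (rule filter_ideal_convex[OF F a b int_pl_uminus[OF int(1)]]) simp
qed

lemma pl_lgrp_sel [simp]:
  "carrier pl_lgrp = int_pl"
  "mult pl_lgrp = (\<lambda>f g. \<lambda>x\<in>cube. f x + g x)"
  "one pl_lgrp = (\<lambda>x\<in>cube. 0)"
  "ljoin pl_lgrp = (\<lambda>f g. \<lambda>x\<in>cube. max (f x) (g x))"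
  "lmeet pl_lgrp = (\<lambda>f g. \<lambda>x\<in>cube. min (f x) (g x))"
  by (simp_all add: pl_lgrp_def)

lemma int_pl_restrict_self: "f \<in> int_pl \<Longrightarrow> (\<lambda>x\<in>cube. f x) = f"
  by (auto simp: int_pl_def extensional_def)

lemma comm_group_pl_lgrp: "comm_group (pl_lgrp :: (real ^ 'n \<Rightarrow> real) lgrp)"
proof (rule comm_groupI)
  fix f :: "real ^ 'n \<Rightarrow> real" assume "f \<in> carrier pl_lgrp"
  then have f: "f \<in> int_pl" by simp
  have "(\<lambda>x\<in>cube. (\<lambda>x\<in>cube. 0) x + f x) = (\<lambda>x\<in>cube. f x)" by auto
  then show "\<one>\<^bsub>pl_lgrp\<^esub> \<otimes>\<^bsub>pl_lgrp\<^esub> f = f"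
    using int_pl_restrict_self[OF f] by simp
  have "(\<lambda>x\<in>cube. (\<lambda>x\<in>cube. - f x) x + f x) = (\<lambda>x\<in>cube. 0)" by auto
  then show "\<exists>g\<in>carrier pl_lgrp. g \<otimes>\<^bsub>pl_lgrp\<^esub> f = \<one>\<^bsub>pl_lgrp\<^esub>"
    using int_pl_uminus[OF f] by (intro bexI[of _ "\<lambda>x\<in>cube. - f x"]) simp_all
  fix g :: "real ^ 'n \<Rightarrow> real" assume "g \<in> carrier pl_lgrp"
  then show "f \<otimes>\<^bsub>pl_lgrp\<^esub> g \<in> carrier pl_lgrp" using int_pl_add[OF f] by simp
  show "f \<otimes>\<^bsub>pl_lgrp\<^esub> g = g \<otimes>\<^bsub>pl_lgrp\<^esub> f" by (simp add: add.commute)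
  fix k :: "real ^ 'n \<Rightarrow> real"
  show "f \<otimes>\<^bsub>pl_lgrp\<^esub> g \<otimes>\<^bsub>pl_lgrp\<^esub> k = f \<otimes>\<^bsub>pl_lgrp\<^esub> (g \<otimes>\<^bsub>pl_lgrp\<^esub> k)" by auto
qed (simp add: int_pl_zero)

lemma subgroup_filter_ideal:
  assumes F: "star_closed F"
  shows "subgroup (filter_ideal F) pl_lgrp"
proof -
  interpret comm_group pl_lgrp by (rule comm_group_pl_lgrp)
  show ?thesis
  proof (rule subgroupI)
    show "filter_ideal F \<noteq> {}" using filter_ideal_zero[OF F] by blast
    fix a assume a: "a \<in> filter_ideal F"
    have "inv\<^bsub>pl_lgrp\<^esub> a = (\<lambda>x\<in>cube. - a x)"
    proof (rule inv_equality)
      show "(\<lambda>x\<in>cube. - a x) \<otimes>\<^bsub>pl_lgrp\<^esub> a = \<one>\<^bsub>pl_lgrp\<^esub>" by auto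
    qed (use filter_ideal_int_pl[OF a] int_pl_uminus in simp_all)
    then show "inv\<^bsub>pl_lgrp\<^esub> a \<in> filter_ideal F" using filter_ideal_closed(4)[OF F a a] by simp
    fix b assume "b \<in> filter_ideal F"
    then show "a \<otimes>\<^bsub>pl_lgrp\<^esub> b \<in> filter_ideal F"
      using filter_ideal_closed(1)[OF F a] by simp
  qed (use filter_ideal_int_pl in auto)
qed

lemma mem_germ_iff:
  "f \<in> germ \<mm> g \<longleftrightarrow>
    (\<exists>i\<in>filter_ideal (germinal_filter free_mv \<mm>). f = (\<lambda>x\<in>cube. i x + g x))"
  by (auto simp: germ_def r_coset_def)

lemma germ_self:
  assumes "p \<in> cube" "g \<in> int_pl"
  shows "g \<in> germ (point_filter p) g"
proof -
  have "(\<lambda>x\<in>cube. (\<lambda>x\<in>cube. 0) x + g x) = (\<lambda>x\<in>cube. g x)" by auto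
  then have "g = (\<lambda>x\<in>cube. (\<lambda>x\<in>cube. 0) x + g x)"
    using int_pl_restrict_self[OF assms(2)] by simp
  then show ?thesis
    unfolding mem_germ_iff using filter_ideal_zero[OF star_closed_germinal_filter[OF assms(1)]] by blast
qed

lemma mem_germ_int_pl:
  assumes "f \<in> germ \<mm> g" "g \<in> int_pl"
  shows "f \<in> int_pl"
  using assms int_pl_add filter_ideal_int_pl unfolding mem_germ_iff by blast

lemma germ_eqI:
  assumes p: "p \<in> cube" and f: "f \<in> int_pl" and g: "g \<in> int_pl"
    and diff: "(\<lambda>x\<in>cube. f x - g x) \<in> filter_ideal (germinal_filter free_mv (point_filter p))"
  shows "germ (point_filter p) f = germ (point_filter p) g"
proof -
  interpret comm_group pl_lgrp by (rule comm_group_pl_lgrp)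
  have "(\<lambda>x\<in>cube. (\<lambda>x\<in>cube. f x - g x) x + g x) = (\<lambda>x\<in>cube. f x)" by auto
  then have "f = (\<lambda>x\<in>cube. (\<lambda>x\<in>cube. f x - g x) x + g x)"
    using int_pl_restrict_self[OF f] by simp
  then have "f \<in> germ (point_filter p) g" using diff unfolding mem_germ_iff by blast
  then show ?thesis
    using repr_independence[of f _ g] g subgroup_filter_ideal[OF star_closed_germinal_filter[OF p]]
    unfolding germ_def by simp
qed

lemma mem_germ_diff:
  assumes "f \<in> germ \<mm> g"
  shows "(\<lambda>x\<in>cube. f x - g x) \<in> filter_ideal (germinal_filter free_mv \<mm>)"
proof -
  obtain i where i: "i \<in> filter_ideal (germinal_filter free_mv \<mm>)" "f = (\<lambda>x\<in>cube. i x + g x)"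
    using assms unfolding mem_germ_iff by blast
  have "(\<lambda>x\<in>cube. f x - g x) = (\<lambda>x\<in>cube. i x)" unfolding i(2) by auto
  then have "(\<lambda>x\<in>cube. f x - g x) = i"
    using int_pl_restrict_self[OF filter_ideal_int_pl[OF i(1)]] by simp
  then show ?thesis using i(1) by simp
qed

lemma germ_lgrp_carrier: "carrier (germ_lgrp \<mm>) = germ \<mm> ` filter_ideal \<mm>"
  by (simp add: germ_lgrp_def)

lemma germ_add:
  assumes p: "p \<in> cube" and f: "f \<in> int_pl" and g: "g \<in> int_pl"
  shows "germ (point_filter p) f <#>\<^bsub>pl_lgrp\<^esub> germ (point_filter p) g =
    germ (point_filter p) (\<lambda>x\<in>cube. f x + g x)"
proof -
  interpret comm_group pl_lgrp by (rule comm_group_pl_lgrp)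
  interpret normal "filter_ideal (germinal_filter free_mv (point_filter p))" pl_lgrp
    by (rule subgroup_imp_normal[OF subgroup_filter_ideal[OF star_closed_germinal_filter[OF p]]])
  show ?thesis using rcos_sum[of f g] f g unfolding germ_def by simp
qed

text \<open>
  The lattice operations are 1-Lipschitz in each argument, so a change of representatives changes
  the result by at most the sum of two members of the germinal ideal, and that ideal is convex.
\<close>

lemma germ_lattice_op:
  fixes p :: "real ^ 'n"
  assumes p: "p \<in> cube" and f: "f \<in> int_pl" and g: "g \<in> int_pl"
    and int: "\<And>a b :: real ^ 'n \<Rightarrow> real. a \<in> int_pl \<Longrightarrow> b \<in> int_pl \<Longrightarrow> (\<lambda>x\<in>cube. k (a x) (b x)) \<in> int_pl"
    and lipschitz: "\<And>s t s' t' :: real. \<bar>k s t - k s' t'\<bar> \<le> \<bar>s - s'\<bar> + \<bar>t - t'\<bar>"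
  shows "(\<Union>a\<in>germ (point_filter p) f. \<Union>b\<in>germ (point_filter p) g.
      germ (point_filter p) (\<lambda>x\<in>cube. k (a x) (b x))) =
    germ (point_filter p) (\<lambda>x\<in>cube. k (f x) (g x))"
proof -
  have "germ (point_filter p) (\<lambda>x\<in>cube. k (a x) (b x)) =
      germ (point_filter p) (\<lambda>x\<in>cube. k (f x) (g x))"
    if a: "a \<in> germ (point_filter p) f" and b: "b \<in> germ (point_filter p) g" for a b
  proof (rule germ_eqI[OF p])
    have ab: "a \<in> int_pl" "b \<in> int_pl" using mem_germ_int_pl a b f g by blast+
    show "(\<lambda>x\<in>cube. k (a x) (b x)) \<in> int_pl" "(\<lambda>x\<in>cube. k (f x) (g x)) \<in> int_pl"
      using int[OF ab] int[OF f g] .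
    show "(\<lambda>x\<in>cube. (\<lambda>x\<in>cube. k (a x) (b x)) x - (\<lambda>x\<in>cube. k (f x) (g x)) x)
        \<in> filter_ideal (germinal_filter free_mv (point_filter p))"
      by (rule filter_ideal_convex[OF star_closed_germinal_filter[OF p] mem_germ_diff[OF a]
            mem_germ_diff[OF b]])
        (simp_all only: int_pl_diff int ab f g, simp add: lipschitz)
  qed
  then show ?thesis
    by (intro UN_constant_eq[OF germ_self[OF p f]] UN_constant_eq[OF germ_self[OF p g]] ballI)
qed

lemma germ_lgrp_ops:
  assumes p: "p \<in> cube" and f: "f \<in> int_pl" and g: "g \<in> int_pl"
  shows "mult (germ_lgrp (point_filter p)) (germ (point_filter p) f) (germ (point_filter p) g) =
      germ (point_filter p) (\<lambda>x\<in>cube. f x + g x)"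
    "ljoin (germ_lgrp (point_filter p)) (germ (point_filter p) f) (germ (point_filter p) g) =
      germ (point_filter p) (\<lambda>x\<in>cube. max (f x) (g x))"
    "lmeet (germ_lgrp (point_filter p)) (germ (point_filter p) f) (germ (point_filter p) g) =
      germ (point_filter p) (\<lambda>x\<in>cube. min (f x) (g x))"
proof -
  show "mult (germ_lgrp (point_filter p)) (germ (point_filter p) f) (germ (point_filter p) g) =
      germ (point_filter p) (\<lambda>x\<in>cube. f x + g x)"
    using germ_add[OF assms] by (simp add: germ_lgrp_def)
  have max_lipschitz: "\<bar>max s t - max s' t'\<bar> \<le> \<bar>s - s'\<bar> + \<bar>t - t'\<bar>" for s t s' t' :: real
    unfolding max_def by (smt (verit))
  have min_lipschitz: "\<bar>min s t - min s' t'\<bar> \<le> \<bar>s - s'\<bar> + \<bar>t - t'\<bar>" for s t s' t' :: real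
    unfolding min_def by (smt (verit))
  show "ljoin (germ_lgrp (point_filter p)) (germ (point_filter p) f) (germ (point_filter p) g) =
      germ (point_filter p) (\<lambda>x\<in>cube. max (f x) (g x))"
    unfolding germ_lgrp_def lgrp.select_convs pl_lgrp_sel
    by (rule germ_lattice_op[where k = max, OF assms]) (rule int_pl_max max_lipschitz; assumption)+
  show "lmeet (germ_lgrp (point_filter p)) (germ (point_filter p) f) (germ (point_filter p) g) =
      germ (point_filter p) (\<lambda>x\<in>cube. min (f x) (g x))"
    unfolding germ_lgrp_def lgrp.select_convs pl_lgrp_sel
    by (rule germ_lattice_op[where k = min, OF assms]) (rule int_pl_min min_lipschitz; assumption)+
qed

lemma lgroup_germ_lgrp:
  assumes p: "p \<in> cube"
  shows "lgroup (germ_lgrp (point_filter p))"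
proof -
  let ?\<mm> = "point_filter p" and ?G = "germ_lgrp (point_filter p)"
  note F = star_closed_point_filter[OF p]
  have int: "a \<in> int_pl" if "a \<in> filter_ideal ?\<mm>" for a
    using that by (rule filter_ideal_int_pl)
  note ops = germ_lgrp_ops[OF p int int]
  note closed = filter_ideal_closed[OF F]
  have one: "one ?G = germ ?\<mm> (\<lambda>x\<in>cube. 0)" by (simp add: germ_lgrp_def)
  have carrierE: "\<exists>a\<in>filter_ideal ?\<mm>. X = germ ?\<mm> a" if "X \<in> carrier ?G" for X
    using that unfolding germ_lgrp_carrier by blast
  have carrierI: "germ ?\<mm> a \<in> carrier ?G" if "a \<in> filter_ideal ?\<mm>" for a
    using that unfolding germ_lgrp_carrier by blast
  have ext: "(\<lambda>x\<in>cube. a x) = a" if "a \<in> filter_ideal ?\<mm>" for a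
    using int_pl_restrict_self[OF int[OF that]] .
  have comm: "comm_group ?G"
  proof (rule comm_groupI)
    show "one ?G \<in> carrier ?G"
      unfolding one using filter_ideal_zero[OF F] by (rule carrierI)
    fix X assume "X \<in> carrier ?G"
    then obtain a where a: "a \<in> filter_ideal ?\<mm>" "X = germ ?\<mm> a" using carrierE by blast
    have "(\<lambda>x\<in>cube. (\<lambda>x\<in>cube. 0) x + a x) = (\<lambda>x\<in>cube. a x)" by auto
    then have "(\<lambda>x\<in>cube. (\<lambda>x\<in>cube. 0) x + a x) = a" using ext[OF a(1)] by simp
    then show "mult ?G (one ?G) X = X"
      unfolding one a(2) ops(1)[OF filter_ideal_zero[OF F] a(1)] by simp
    have "(\<lambda>x\<in>cube. (\<lambda>x\<in>cube. - a x) x + a x) = (\<lambda>x\<in>cube. 0)" by auto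
    then have "mult ?G (germ ?\<mm> (\<lambda>x\<in>cube. - a x)) X = one ?G"
      unfolding one a(2) ops(1)[OF closed(4)[OF a(1) a(1)] a(1)] by simp
    then show "\<exists>Y\<in>carrier ?G. mult ?G Y X = one ?G"
      using carrierI[OF closed(4)[OF a(1) a(1)]] by blast
    fix Y assume "Y \<in> carrier ?G"
    then obtain b where b: "b \<in> filter_ideal ?\<mm>" "Y = germ ?\<mm> b" using carrierE by blast
    show "mult ?G X Y \<in> carrier ?G"
      unfolding a(2) b(2) ops(1)[OF a(1) b(1)] using closed(1)[OF a(1) b(1)] by (rule carrierI)
    show "mult ?G X Y = mult ?G Y X"
      unfolding a(2) b(2) ops(1)[OF a(1) b(1)] ops(1)[OF b(1) a(1)] by (simp add: add.commute)
    fix Z assume "Z \<in> carrier ?G"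
    then obtain c where c: "c \<in> filter_ideal ?\<mm>" "Z = germ ?\<mm> c" using carrierE by blast
    show "mult ?G (mult ?G X Y) Z = mult ?G X (mult ?G Y Z)"
      unfolding a(2) b(2) c(2) ops(1)[OF a(1) b(1)] ops(1)[OF b(1) c(1)]
        ops(1)[OF closed(1)[OF a(1) b(1)] c(1)] ops(1)[OF a(1) closed(1)[OF b(1) c(1)]]
      by (rule arg_cong[of _ _ "germ ?\<mm>"]) auto
  qed
  have lattice: "ljoin ?G X Y \<in> carrier ?G \<and> lmeet ?G X Y \<in> carrier ?G \<and>
        ljoin ?G X Y = ljoin ?G Y X \<and> lmeet ?G X Y = lmeet ?G Y X \<and>
        ljoin ?G X (lmeet ?G X Y) = X \<and> lmeet ?G X (ljoin ?G X Y) = X"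
    if XY: "X \<in> carrier ?G" "Y \<in> carrier ?G" for X Y
  proof -
    obtain a where a: "a \<in> filter_ideal ?\<mm>" "X = germ ?\<mm> a" using carrierE XY by blast
    obtain b where b: "b \<in> filter_ideal ?\<mm>" "Y = germ ?\<mm> b" using carrierE XY by blast
    note ab = closed(2,3)[OF a(1) b(1)]
    have "(\<lambda>x\<in>cube. max (a x) ((\<lambda>x\<in>cube. min (a x) (b x)) x)) = (\<lambda>x\<in>cube. a x)"
      "(\<lambda>x\<in>cube. min (a x) ((\<lambda>x\<in>cube. max (a x) (b x)) x)) = (\<lambda>x\<in>cube. a x)"
      by (auto simp: max_def min_def)
    then show ?thesis
      unfolding a(2) b(2) ops[OF a(1) b(1)] ops[OF b(1) a(1)] ops[OF a(1) ab(1)] ops[OF a(1) ab(2)]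
      using carrierI[OF ab(1)] carrierI[OF ab(2)] ext[OF a(1)]
      by (simp add: max.commute min.commute)
  qed
  have assoc_distrib: "ljoin ?G (ljoin ?G X Y) Z = ljoin ?G X (ljoin ?G Y Z) \<and>
        lmeet ?G (lmeet ?G X Y) Z = lmeet ?G X (lmeet ?G Y Z) \<and>
        mult ?G Z (ljoin ?G X Y) = ljoin ?G (mult ?G Z X) (mult ?G Z Y) \<and>
        mult ?G Z (lmeet ?G X Y) = lmeet ?G (mult ?G Z X) (mult ?G Z Y)"
    if XY: "X \<in> carrier ?G" "Y \<in> carrier ?G" "Z \<in> carrier ?G" for X Y Z
  proof -
    obtain a where a: "a \<in> filter_ideal ?\<mm>" "X = germ ?\<mm> a" using carrierE XY by blast
    obtain b where b: "b \<in> filter_ideal ?\<mm>" "Y = germ ?\<mm> b" using carrierE XY by blast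
    obtain c where c: "c \<in> filter_ideal ?\<mm>" "Z = germ ?\<mm> c" using carrierE XY by blast
    note ab = closed[OF a(1) b(1)] and bc = closed[OF b(1) c(1)]
      and ca = closed[OF c(1) a(1)] and cb = closed[OF c(1) b(1)]
    show ?thesis
      unfolding a(2) b(2) c(2) ops[OF a(1) b(1)] ops[OF b(1) c(1)] ops[OF c(1) a(1)] ops[OF c(1) b(1)]
        ops[OF ab(2) c(1)] ops[OF ab(3) c(1)] ops[OF a(1) bc(2)] ops[OF a(1) bc(3)]
        ops[OF c(1) ab(2)] ops[OF c(1) ab(3)] ops[OF ca(1) cb(1)]
      by (intro conjI arg_cong[of _ _ "germ ?\<mm>"]) (auto simp: max_def min_def)
  qed
  show ?thesis
    unfolding lgroup_def
    by (rule conjI[OF comm], rule conjI)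
      (intro ballI, erule (1) lattice, intro ballI, erule (2) assoc_distrib)
qed


section \<open>The homomorphism of germs induced by an endomorphism\<close>

context
  fixes \<sigma> :: "(real ^ 'n \<Rightarrow> real) \<Rightarrow> real ^ 'n \<Rightarrow> real"
  assumes \<sigma>: "\<sigma> \<in> mv_hom free_mv free_mv"
begin

lemma endo_free_carrier: "r \<in> free_carrier \<Longrightarrow> \<sigma> r \<in> free_carrier"
  using mv_homD(3)[OF \<sigma>] by simp

lemma induced_map_nth: "x \<in> cube \<Longrightarrow> induced_map \<sigma> x $ i = \<sigma> (coord i) x"
  by (simp add: induced_map_def)

lemma induced_map_cube: "induced_map \<sigma> \<in> cube \<rightarrow> cube"
proof
  fix x :: "real ^ 'n" assume x: "x \<in> cube"
  then show "induced_map \<sigma> x \<in> cube"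
    using free_carrier_range[OF endo_free_carrier[OF free_carrier.coord] x]
    by (auto simp: cube_def induced_map_nth[OF x])
qed

text \<open>
  Both sides are homomorphisms in \<open>r\<close>, and by the definition of \<open>S\<close> they agree on the generators.
\<close>

lemma endo_eq_compose:
  assumes "r \<in> free_carrier"
  shows "\<sigma> r = compose cube r (induced_map \<sigma>)"
proof -
  let ?S = "induced_map \<sigma>"
  have S: "?S x \<in> cube" if "x \<in> cube" for x using induced_map_cube that by blast
  have "\<sigma> r x = r (?S x)" if x: "x \<in> cube" for x
    using assms
  proof (induction rule: free_carrier.induct)
    case (coord i)
    have "coord i (?S x) = ?S x $ i" using S[OF x] by (simp add: coord_def)
    then show ?case by (simp only: induced_map_nth[OF x])
  next
    case zero
    show ?case unfolding mv_homD(1)[OF \<sigma>, unfolded free_mv_sel] using S[OF x] x by simp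
  next
    case one
    show ?case unfolding mv_homD(2)[OF \<sigma>, unfolded free_mv_sel] using S[OF x] x by simp
  next
    case (star r s)
    then show ?case
      unfolding mv_homD(4)[OF \<sigma>, unfolded free_mv_sel, OF star.hyps] using S[OF x] x by simp
  next
    case (imp r s)
    then show ?case
      unfolding mv_homD(5)[OF \<sigma>, unfolded free_mv_sel, OF imp.hyps] using S[OF x] x by simp
  qed
  then show ?thesis
    using free_carrier_extensional[OF endo_free_carrier[OF assms]]
    by (auto simp: compose_def extensional_def)
qed

lemma induced_map_nth_int_pl: "(\<lambda>x\<in>cube. induced_map \<sigma> x $ i) \<in> int_pl"
proof -
  have "\<sigma> (coord i) \<in> int_pl"
    by (rule free_carrier_int_pl[OF endo_free_carrier[OF free_carrier.coord]])
  moreover from this have "(\<lambda>x\<in>cube. induced_map \<sigma> x $ i) = \<sigma> (coord i)"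
    by (auto simp: induced_map_nth int_pl_def extensional_def)
  ultimately show ?thesis by simp
qed

lemma compose_induced_map_int_pl: "g \<in> int_pl \<Longrightarrow> compose cube g (induced_map \<sigma>) \<in> int_pl"
  by (rule int_pl_compose[OF _ induced_map_cube induced_map_nth_int_pl])

lemma endo_point_filter:
  assumes "p \<in> cube" "r \<in> free_carrier"
  shows "\<sigma> r \<in> point_filter p \<longleftrightarrow> r \<in> point_filter (induced_map \<sigma> p)"
  using assms endo_free_carrier[OF assms(2)] endo_eq_compose[OF assms(2)]
  by (simp add: point_filter_def compose_def)

text \<open>
  A prime filter below \<open>\<pi>(p)\<close> pulls back along \<open>\<sigma>\<close> to a prime filter below \<open>\<pi>(S p)\<close>, so a member
  of all the latter is mapped to a member of all the former.
\<close>

lemma endo_germinal_filter: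
  assumes p: "p \<in> cube" and r: "r \<in> germinal_filter free_mv (point_filter (induced_map \<sigma> p))"
  shows "\<sigma> r \<in> germinal_filter free_mv (point_filter p)"
  unfolding germinal_filter_def
proof (rule InterI)
  fix Q assume "Q \<in> {Q. prime_mv_filter free_mv Q \<and> Q \<subseteq> point_filter p}"
  then have Q: "prime_mv_filter free_mv Q" "Q \<subseteq> point_filter p" by auto
  let ?Q' = "{r \<in> carrier free_mv. \<sigma> r \<in> Q}"
  have "prime_mv_filter free_mv ?Q'"
    by (rule prime_mv_filter_preimage[OF mv_algebra_free_mv \<sigma> Q(1)])
  moreover have "?Q' \<subseteq> point_filter (induced_map \<sigma> p)"
    using Q(2) endo_point_filter[OF p] by auto
  ultimately have "r \<in> ?Q'" using r unfolding germinal_filter_def by blast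
  then show "\<sigma> r \<in> Q" by simp
qed

lemma filter_ideal_compose:
  assumes FF': "\<And>r. r \<in> F \<Longrightarrow> r \<in> free_carrier \<and> \<sigma> r \<in> F'" and g: "g \<in> filter_ideal F"
  shows "compose cube g (induced_map \<sigma>) \<in> filter_ideal F'"
proof -
  obtain r k where r: "r \<in> F" "\<And>x. x \<in> cube \<Longrightarrow> \<bar>g x\<bar> \<le> of_nat k * (1 - r x)"
    using g unfolding filter_ideal_def by blast
  have "\<bar>compose cube g (induced_map \<sigma>) x\<bar> \<le> of_nat k * (1 - \<sigma> r x)" if x: "x \<in> cube" for x
    using r(2)[of "induced_map \<sigma> x"] induced_map_cube x endo_eq_compose[of r] FF'[OF r(1)]
    by (auto simp: compose_def)
  then show ?thesis
    unfolding filter_ideal_def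
    using compose_induced_map_int_pl[OF filter_ideal_int_pl[OF g]] FF'[OF r(1)] by blast
qed

lemma filter_ideal_point_filter_compose:
  assumes "p \<in> cube" "g \<in> filter_ideal (point_filter (induced_map \<sigma> p))"
  shows "compose cube g (induced_map \<sigma>) \<in> filter_ideal (point_filter p)"
  by (rule filter_ideal_compose[OF _ assms(2)])
    (use endo_point_filter[OF assms(1)] in \<open>auto simp: point_filter_def\<close>)

lemma filter_ideal_germinal_filter_compose:
  assumes p: "p \<in> cube"
    and g: "g \<in> filter_ideal (germinal_filter free_mv (point_filter (induced_map \<sigma> p)))"
  shows "compose cube g (induced_map \<sigma>) \<in> filter_ideal (germinal_filter free_mv (point_filter p))"
proof (rule filter_ideal_compose[OF _ g])
  have "induced_map \<sigma> p \<in> cube" using induced_map_cube p by blast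
  then show "r \<in> free_carrier \<and> \<sigma> r \<in> germinal_filter free_mv (point_filter p)"
    if "r \<in> germinal_filter free_mv (point_filter (induced_map \<sigma> p))" for r
    using that star_closed_germinal_filter endo_germinal_filter[OF p that]
    unfolding star_closed_def by blast
qed

text \<open>
  Representatives of one germ at \<open>S p\<close> differ by a member of the germinal ideal, and composition
  with \<open>S\<close> maps that ideal into the germinal ideal at \<open>p\<close>; so the image in the definition of the
  pullback is a singleton.
\<close>

lemma germ_pullback_germ:
  assumes p: "p \<in> cube" and g: "g \<in> filter_ideal (point_filter (induced_map \<sigma> p))"
  shows "germ_pullback (induced_map \<sigma>) (point_filter (induced_map \<sigma> p)) (point_filter p)
      (germ (point_filter (induced_map \<sigma> p)) g) =
    germ (point_filter p) (compose cube g (induced_map \<sigma>))"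
proof -
  let ?S = "induced_map \<sigma>" and ?\<nn> = "point_filter (induced_map \<sigma> p)"
  have q: "?S p \<in> cube" using induced_map_cube p by blast
  have g': "g \<in> int_pl" by (rule filter_ideal_int_pl[OF g])
  have "germ (point_filter p) (compose cube f ?S) = germ (point_filter p) (compose cube g ?S)"
    if f: "f \<in> germ ?\<nn> g" for f
  proof (rule germ_eqI[OF p])
    show "compose cube f ?S \<in> int_pl" "compose cube g ?S \<in> int_pl"
      using compose_induced_map_int_pl mem_germ_int_pl[OF f g'] g' by blast+
    have "(\<lambda>x\<in>cube. compose cube f ?S x - compose cube g ?S x) =
        compose cube (\<lambda>x\<in>cube. f x - g x) ?S"
      unfolding compose_def by (rule restrict_ext) (simp add: funcset_mem[OF induced_map_cube])
    then show "(\<lambda>x\<in>cube. compose cube f ?S x - compose cube g ?S x)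
        \<in> filter_ideal (germinal_filter free_mv (point_filter p))"
      using filter_ideal_germinal_filter_compose[OF p mem_germ_diff[OF f]] by simp
  qed
  then have "(\<lambda>f. germ (point_filter p) (compose cube f ?S)) ` germ ?\<nn> g =
      {germ (point_filter p) (compose cube g ?S)}"
    using germ_self[OF q g'] by blast
  moreover have "germ ?\<nn> g \<in> carrier (germ_lgrp ?\<nn>)"
    using g by (simp add: germ_lgrp_carrier)
  ultimately show ?thesis by (simp add: germ_pullback_def)
qed

lemma germ_pullback_lgroup_hom:
  assumes p: "p \<in> cube"
  shows "germ_pullback (induced_map \<sigma>) (point_filter (induced_map \<sigma> p)) (point_filter p)
    \<in> lgroup_hom (germ_lgrp (point_filter (induced_map \<sigma> p))) (germ_lgrp (point_filter p))"
proof -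
  let ?S = "induced_map \<sigma>" and ?\<nn> = "point_filter (induced_map \<sigma> p)" and ?\<mm> = "point_filter p"
  let ?\<sigma> = "germ_pullback ?S ?\<nn> ?\<mm>"
  have q: "?S p \<in> cube" using induced_map_cube p by blast
  note pull = germ_pullback_germ[OF p]
  have "?\<sigma> X \<in> carrier (germ_lgrp ?\<mm>)" if "X \<in> carrier (germ_lgrp ?\<nn>)" for X
    using that filter_ideal_point_filter_compose[OF p] pull unfolding germ_lgrp_carrier by auto
  moreover have "?\<sigma> \<in> extensional (carrier (germ_lgrp ?\<nn>))"
    by (simp add: germ_pullback_def)
  moreover have "?\<sigma> (mult (germ_lgrp ?\<nn>) X Y) = mult (germ_lgrp ?\<mm>) (?\<sigma> X) (?\<sigma> Y) \<and>
      ?\<sigma> (ljoin (germ_lgrp ?\<nn>) X Y) = ljoin (germ_lgrp ?\<mm>) (?\<sigma> X) (?\<sigma> Y) \<and>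
      ?\<sigma> (lmeet (germ_lgrp ?\<nn>) X Y) = lmeet (germ_lgrp ?\<mm>) (?\<sigma> X) (?\<sigma> Y)"
    if XY: "X \<in> carrier (germ_lgrp ?\<nn>)" "Y \<in> carrier (germ_lgrp ?\<nn>)" for X Y
  proof -
    obtain a where a: "a \<in> filter_ideal ?\<nn>" "X = germ ?\<nn> a"
      using XY unfolding germ_lgrp_carrier by blast
    obtain b where b: "b \<in> filter_ideal ?\<nn>" "Y = germ ?\<nn> b"
      using XY unfolding germ_lgrp_carrier by blast
    note int = filter_ideal_int_pl[OF a(1)] filter_ideal_int_pl[OF b(1)]
    note closed = filter_ideal_closed[OF star_closed_point_filter[OF q] a(1) b(1)]
    show ?thesis
      unfolding a(2) b(2) germ_lgrp_ops[OF q int] pull[OF a(1)] pull[OF b(1)]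
        pull[OF closed(1)] pull[OF closed(2)] pull[OF closed(3)]
        germ_lgrp_ops[OF p compose_induced_map_int_pl[OF int(1)] compose_induced_map_int_pl[OF int(2)]]
      unfolding compose_def
      by (intro conjI arg_cong[of _ _ "germ ?\<mm>"] restrict_ext)
        (simp_all add: funcset_mem[OF induced_map_cube])
  qed
  ultimately show ?thesis by (auto simp: lgroup_hom_def PiE_def)
qed

text \<open>All coordinates of \<open>S\<close> are eventually linear along a ray, hence so is \<open>S\<close>.\<close>

lemma induced_map_eventually_linear_on_ray:
  assumes p: "p \<in> cube" and v: "v \<in> tangent_cone p"
  shows "\<exists>w. \<forall>\<^sub>F h in at_right 0. induced_map \<sigma> (p + h *\<^sub>R v) = induced_map \<sigma> p + h *\<^sub>R w"
proof -
  have in_cube: "\<forall>\<^sub>F h in at_right 0. p + h *\<^sub>R v \<in> cube"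
    using v by (simp add: tangent_cone_def)
  have "\<exists>d. \<forall>\<^sub>F h in at_right 0. \<sigma> (coord i) (p + h *\<^sub>R v) = \<sigma> (coord i) p + h * d" for i
    by (rule int_pl_eventually_linear_on_ray[OF free_carrier_int_pl[OF endo_free_carrier[OF
            free_carrier.coord]] p v])
  then obtain d where
    "\<And>i. \<forall>\<^sub>F h in at_right 0. \<sigma> (coord i) (p + h *\<^sub>R v) = \<sigma> (coord i) p + h * d i"
    by metis
  then have "\<forall>\<^sub>F h in at_right 0. \<forall>i. \<sigma> (coord i) (p + h *\<^sub>R v) = \<sigma> (coord i) p + h * d i"
    by (simp add: eventually_all_finite)
  with in_cube have "\<forall>\<^sub>F h in at_right 0.
      induced_map \<sigma> (p + h *\<^sub>R v) = induced_map \<sigma> p + h *\<^sub>R (\<chi> i. d i)"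
    by eventually_elim (simp add: vec_eq_iff induced_map_nth p)
  then show ?thesis by blast
qed

lemma tsujii_diff_eventually:
  assumes p: "p \<in> cube" and v: "v \<in> tangent_cone p"
  shows "\<forall>\<^sub>F h in at_right 0.
      induced_map \<sigma> (p + h *\<^sub>R v) = induced_map \<sigma> p + h *\<^sub>R tsujii_diff (induced_map \<sigma>) p v"
    and "((\<lambda>h. (1 / h) *\<^sub>R (induced_map \<sigma> (p + h *\<^sub>R v) - induced_map \<sigma> p)) \<longlongrightarrow>
      tsujii_diff (induced_map \<sigma>) p v) (at_right 0)"
    and "tsujii_diff (induced_map \<sigma>) p v \<in> tangent_cone (induced_map \<sigma> p)"
proof -
  let ?S = "induced_map \<sigma>"
  obtain w where w: "\<forall>\<^sub>F h in at_right 0. ?S (p + h *\<^sub>R v) = ?S p + h *\<^sub>R w"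
    using induced_map_eventually_linear_on_ray[OF assms] by blast
  with eventually_at_right_less[of 0]
  have "\<forall>\<^sub>F h in at_right 0. (1 / h) *\<^sub>R (?S (p + h *\<^sub>R v) - ?S p) = w"
    by eventually_elim simp
  then have lim: "((\<lambda>h. (1 / h) *\<^sub>R (?S (p + h *\<^sub>R v) - ?S p)) \<longlongrightarrow> w) (at_right 0)"
    by (rule tendsto_eventually)
  have eq: "tsujii_diff ?S p v = w"
    using v tendsto_Lim[OF trivial_limit_at_right_real lim] by (simp add: tsujii_diff_def)
  show "\<forall>\<^sub>F h in at_right 0. ?S (p + h *\<^sub>R v) = ?S p + h *\<^sub>R tsujii_diff ?S p v"
    unfolding eq by (rule w)
  show "((\<lambda>h. (1 / h) *\<^sub>R (?S (p + h *\<^sub>R v) - ?S p)) \<longlongrightarrow> tsujii_diff ?S p v) (at_right 0)"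
    unfolding eq by (rule lim)
  have "\<forall>\<^sub>F h in at_right 0. p + h *\<^sub>R v \<in> cube"
    using v by (simp add: tangent_cone_def)
  with w have "\<forall>\<^sub>F h in at_right 0. ?S p + h *\<^sub>R w \<in> cube"
    by eventually_elim (use induced_map_cube in \<open>force simp: Pi_iff\<close>)
  then show "tsujii_diff ?S p v \<in> tangent_cone (?S p)"
    unfolding eq by (simp add: tangent_cone_def)
qed

end


section \<open>Directional derivatives of germs\<close>

lemma germinal_ideal_eventually_zero_on_ray:
  assumes p: "p \<in> cube" and w: "w \<in> tangent_cone p"
    and i: "i \<in> filter_ideal (germinal_filter free_mv (point_filter p))"
  shows "\<forall>\<^sub>F h in at_right 0. i (p + h *\<^sub>R w) = 0"
proof -
  obtain r k where r: "r \<in> germinal_filter free_mv (point_filter p)"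
    "\<And>x. x \<in> cube \<Longrightarrow> \<bar>i x\<bar> \<le> of_nat k * (1 - r x)"
    using i unfolding filter_ideal_def by blast
  have "\<forall>\<^sub>F h in at_right 0. r (p + h *\<^sub>R w) = 1"
    using germinal_filter_subset_ray_filter[OF p w] r(1) by (auto simp: ray_filter_def)
  moreover have "\<forall>\<^sub>F h in at_right 0. p + h *\<^sub>R w \<in> cube"
    using w by (simp add: tangent_cone_def)
  ultimately show ?thesis
    by eventually_elim (use r(2) in force)
qed

lemma germ_diff_tendsto:
  assumes p: "p \<in> cube" and g: "g \<in> filter_ideal (point_filter p)" and w: "w \<in> tangent_cone p"
  shows "((\<lambda>h. (g (p + h *\<^sub>R w) - g p) / h) \<longlongrightarrow> germ_diff p (germ (point_filter p) g) w)
    (at_right 0)"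
proof -
  let ?X = "germ (point_filter p) g"
  let ?D = "\<lambda>f d. ((\<lambda>h. (f (p + h *\<^sub>R w) - f p) / h) \<longlongrightarrow> d) (at_right 0)"
  have g': "g \<in> int_pl" by (rule filter_ideal_int_pl[OF g])
  have in_cube: "\<forall>\<^sub>F h in at_right 0. p + h *\<^sub>R w \<in> cube"
    using w by (simp add: tangent_cone_def)
  obtain d where d: "\<forall>\<^sub>F h in at_right 0. g (p + h *\<^sub>R w) = g p + h * d"
    using int_pl_eventually_linear_on_ray[OF g' p w] by blast
  have D: "?D f d" if f: "f \<in> ?X" for f
  proof -
    obtain i where i: "i \<in> filter_ideal (germinal_filter free_mv (point_filter p))"
      "f = (\<lambda>x\<in>cube. i x + g x)" using f unfolding mem_germ_iff by blast
    \<comment> \<open>the zero direction is tangent, and its ray is the point \<open>p\<close> itself\<close>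
    have "i p = 0"
      using germinal_ideal_eventually_zero_on_ray[OF p zero_in_tangent_cone[OF p] i(1)] by simp
    then have fp: "f p = g p" using i(2) p by simp
    from eventually_at_right_less[of 0] in_cube d germinal_ideal_eventually_zero_on_ray[OF p w i(1)]
    have "\<forall>\<^sub>F h in at_right 0. (f (p + h *\<^sub>R w) - f p) / h = d"
      by eventually_elim (simp add: fp, simp add: i(2))
    then show ?thesis by (rule tendsto_eventually)
  qed
  have unique: "e = d" if "\<forall>f\<in>?X. ?D f e" for e
    using that D germ_self[OF p g'] tendsto_unique[OF trivial_limit_at_right_real] by blast
  have "(THE d. \<forall>f\<in>?X. ?D f d) = d"
  proof (rule the_equality)
    show "\<forall>f\<in>?X. ?D f d" using D by blast
  qed (rule unique)
  then have "germ_diff p ?X w = d" using w by (simp add: germ_diff_def)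
  then show ?thesis using D[OF germ_self[OF p g']] by simp
qed

lemma germ_diff_eqI:
  assumes "p \<in> cube" "g \<in> filter_ideal (point_filter p)" "w \<in> tangent_cone p"
    "((\<lambda>h. (g (p + h *\<^sub>R w) - g p) / h) \<longlongrightarrow> d) (at_right 0)"
  shows "germ_diff p (germ (point_filter p) g) w = d"
  using tendsto_unique[OF trivial_limit_at_right_real germ_diff_tendsto[OF assms(1-3)] assms(4)] .

text \<open>
  For functions vanishing at \<open>p\<close> the difference quotient at \<open>h > 0\<close> commutes with sums, maxima and
  minima, and so does the limit.
\<close>

lemma eval_germ_diff_lgroup_hom:
  assumes p: "p \<in> cube" and v: "v \<in> tangent_cone p"
  shows "compose (carrier (germ_lgrp (point_filter p))) (eval_at v) (germ_diff p)
    \<in> lgroup_hom (germ_lgrp (point_filter p)) real_lgrp"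
proof -
  let ?\<mm> = "point_filter p"
  let ?D = "\<lambda>X. germ_diff p X v"
  have in_cube: "\<forall>\<^sub>F h in at_right 0. p + h *\<^sub>R v \<in> cube"
    using v by (simp add: tangent_cone_def)
  have ops: "mult (germ_lgrp ?\<mm>) X Y \<in> carrier (germ_lgrp ?\<mm>) \<and>
      ljoin (germ_lgrp ?\<mm>) X Y \<in> carrier (germ_lgrp ?\<mm>) \<and>
      lmeet (germ_lgrp ?\<mm>) X Y \<in> carrier (germ_lgrp ?\<mm>) \<and>
      ?D (mult (germ_lgrp ?\<mm>) X Y) = ?D X + ?D Y \<and>
      ?D (ljoin (germ_lgrp ?\<mm>) X Y) = max (?D X) (?D Y) \<and>
      ?D (lmeet (germ_lgrp ?\<mm>) X Y) = min (?D X) (?D Y)"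
    if XY: "X \<in> carrier (germ_lgrp ?\<mm>)" "Y \<in> carrier (germ_lgrp ?\<mm>)" for X Y
  proof -
    obtain a where a: "a \<in> filter_ideal ?\<mm>" "X = germ ?\<mm> a"
      using XY unfolding germ_lgrp_carrier by blast
    obtain b where b: "b \<in> filter_ideal ?\<mm>" "Y = germ ?\<mm> b"
      using XY unfolding germ_lgrp_carrier by blast
    note int = filter_ideal_int_pl[OF a(1)] filter_ideal_int_pl[OF b(1)]
    note closed = filter_ideal_closed[OF star_closed_point_filter[OF p] a(1) b(1)]
    have zero: "a p = 0" "b p = 0"
      using filter_ideal_point_filter_zero[OF p] a(1) b(1) by auto
    have A: "((\<lambda>h. a (p + h *\<^sub>R v) / h) \<longlongrightarrow> ?D X) (at_right 0)"
      using germ_diff_tendsto[OF p a(1) v] unfolding zero a(2) by simp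
    have B: "((\<lambda>h. b (p + h *\<^sub>R v) / h) \<longlongrightarrow> ?D Y) (at_right 0)"
      using germ_diff_tendsto[OF p b(1) v] unfolding zero b(2) by simp
    have D: "?D (germ ?\<mm> (\<lambda>x\<in>cube. k (a x) (b x))) = k (?D X) (?D Y)"
      if k: "(\<lambda>x\<in>cube. k (a x) (b x)) \<in> filter_ideal ?\<mm>" "k 0 0 = 0"
        "\<And>s t h. h > 0 \<Longrightarrow> k (s / h) (t / h) = k s t / h"
        "((\<lambda>h. k (a (p + h *\<^sub>R v) / h) (b (p + h *\<^sub>R v) / h)) \<longlongrightarrow> k (?D X) (?D Y)) (at_right 0)"
      for k :: "real \<Rightarrow> real \<Rightarrow> real"
    proof (rule germ_diff_eqI[OF p k(1) v])
      from in_cube eventually_at_right_less[of 0]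
      have "\<forall>\<^sub>F h in at_right 0. k (a (p + h *\<^sub>R v) / h) (b (p + h *\<^sub>R v) / h) =
          ((\<lambda>x\<in>cube. k (a x) (b x)) (p + h *\<^sub>R v) - (\<lambda>x\<in>cube. k (a x) (b x)) p) / h"
        by eventually_elim (simp add: p zero k(2,3))
      then show "((\<lambda>h. ((\<lambda>x\<in>cube. k (a x) (b x)) (p + h *\<^sub>R v) - (\<lambda>x\<in>cube. k (a x) (b x)) p) / h)
          \<longlongrightarrow> k (?D X) (?D Y)) (at_right 0)"
        by (rule Lim_transform_eventually[OF k(4)])
    qed
    have "?D (germ ?\<mm> (\<lambda>x\<in>cube. a x + b x)) = ?D X + ?D Y"
      by (rule D[where k = "(+)", OF closed(1)]) (simp_all add: add_divide_distrib tendsto_add A B)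
    moreover have "?D (germ ?\<mm> (\<lambda>x\<in>cube. max (a x) (b x))) = max (?D X) (?D Y)"
      by (rule D[where k = max, OF closed(2)]) (simp_all add: max_divide_distrib_right tendsto_max A B)
    moreover have "?D (germ ?\<mm> (\<lambda>x\<in>cube. min (a x) (b x))) = min (?D X) (?D Y)"
      by (rule D[where k = min, OF closed(3)]) (simp_all add: min_divide_distrib_right tendsto_min A B)
    ultimately show ?thesis
      using closed unfolding a(2) b(2) germ_lgrp_ops[OF p int] germ_lgrp_carrier by blast
  qed
  then show ?thesis
    by (auto simp: lgroup_hom_def real_lgrp_def eval_at_def compose_def)
qed


section \<open>The differential as the action on \<open>\<ell>\<close>-homomorphisms\<close>

text \<open>
  Near \<open>p\<close> the map \<open>S\<close> carries the ray from \<open>p\<close> in direction \<open>v\<close> onto the ray from \<open>S p\<close> in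
  direction \<open>w\<close>, the differential at \<open>v\<close>, at the same speed.  Hence the difference quotients of
  \<open>g \<circ> S\<close> along the first ray are those of \<open>g\<close> along the second.
\<close>

lemma germ_diff_compose:
  assumes \<sigma>: "\<sigma> \<in> mv_hom free_mv free_mv" and p: "p \<in> cube" and v: "v \<in> tangent_cone p"
    and g: "g \<in> filter_ideal (point_filter (induced_map \<sigma> p))"
  shows "germ_diff p (germ (point_filter p) (compose cube g (induced_map \<sigma>))) v =
    germ_diff (induced_map \<sigma> p) (germ (point_filter (induced_map \<sigma> p)) g)
      (tsujii_diff (induced_map \<sigma>) p v)"
proof (rule germ_diff_eqI[OF p filter_ideal_point_filter_compose[OF \<sigma> p g] v])
  let ?S = "induced_map \<sigma>" and ?w = "tsujii_diff (induced_map \<sigma>) p v"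
  note T = tsujii_diff_eventually[OF \<sigma> p v]
  have q: "?S p \<in> cube" using induced_map_cube[OF \<sigma>] p by blast
  have "\<forall>\<^sub>F h in at_right 0. p + h *\<^sub>R v \<in> cube"
    using v by (simp add: tangent_cone_def)
  with T(1) have "\<forall>\<^sub>F h in at_right 0. (g (?S p + h *\<^sub>R ?w) - g (?S p)) / h =
      (compose cube g ?S (p + h *\<^sub>R v) - compose cube g ?S p) / h"
    by eventually_elim (simp add: compose_def p)
  then show "((\<lambda>h. (compose cube g ?S (p + h *\<^sub>R v) - compose cube g ?S p) / h) \<longlongrightarrow>
      germ_diff (?S p) (germ (point_filter (?S p)) g) ?w) (at_right 0)"
    by (rule Lim_transform_eventually[OF germ_diff_tendsto[OF q g T(3)]])
qed

lemma lgroup_hom_compose: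
  assumes "\<phi> \<in> lgroup_hom H K" "\<psi> \<in> lgroup_hom G H" "lgroup G"
  shows "compose (carrier G) \<phi> \<psi> \<in> lgroup_hom G K"
proof -
  have "mult G a b \<in> carrier G \<and> ljoin G a b \<in> carrier G \<and> lmeet G a b \<in> carrier G"
    if "a \<in> carrier G" "b \<in> carrier G" for a b
  proof -
    interpret comm_group G using assms(3) by (simp add: lgroup_def)
    show ?thesis using assms(3) that by (simp add: lgroup_def)
  qed
  moreover have "\<And>a. a \<in> carrier G \<Longrightarrow> \<psi> a \<in> carrier H" "\<And>a. a \<in> carrier H \<Longrightarrow> \<phi> a \<in> carrier K"
    using assms(1,2) by (auto simp: lgroup_hom_def)
  ultimately show ?thesis
    using assms(1,2) by (simp add: lgroup_hom_def compose_def PiE_iff)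
qed

theorem theorem5p6:
  fixes \<sigma> :: "(real ^ 'n \<Rightarrow> real) \<Rightarrow> real ^ 'n \<Rightarrow> real"
    and S :: "real ^ 'n \<Rightarrow> real ^ 'n"
    and p q :: "real ^ 'n"
    and \<mm> \<nn> :: "(real ^ 'n \<Rightarrow> real) set"
    and \<sigma>bar :: "(real ^ 'n \<Rightarrow> real) set \<Rightarrow> (real ^ 'n \<Rightarrow> real) set"
    and \<sigma>bar' :: "((real ^ 'n \<Rightarrow> real) set \<Rightarrow> real) \<Rightarrow> (real ^ 'n \<Rightarrow> real) set \<Rightarrow> real"
  assumes "\<sigma> \<in> mv_hom free_mv free_mv"
    and "S = induced_map \<sigma>"
    and "p \<in> cube"
    and "q = S p"
    and "\<mm> = point_filter p"
    and "\<nn> = point_filter q"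
    and "\<sigma>bar = germ_pullback S \<nn> \<mm>"
    and "\<sigma>bar' = (\<lambda>\<phi>\<in>lgroup_hom (germ_lgrp \<mm>) real_lgrp.
                    compose (carrier (germ_lgrp \<nn>)) \<phi> \<sigma>bar)"
  shows \<comment> \<open>The last conjunct is the asserted correspondence; the others say that the objects in it
    are well defined and have the intended values.\<close>
    "lgroup (germ_lgrp \<mm>) \<and> lgroup (germ_lgrp \<nn>) \<and>
     \<sigma>bar \<in> lgroup_hom (germ_lgrp \<nn>) (germ_lgrp \<mm>) \<and>
     (\<forall>g\<in>filter_ideal \<nn>. \<sigma>bar (germ \<nn> g) = germ \<mm> (compose cube g S)) \<and>
     \<sigma>bar' \<in> lgroup_hom (germ_lgrp \<mm>) real_lgrp \<rightarrow>\<^sub>E lgroup_hom (germ_lgrp \<nn>) real_lgrp \<and>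
     (\<forall>g\<in>filter_ideal \<mm>. \<forall>w\<in>tangent_cone p.
        ((\<lambda>h. (g (p + h *\<^sub>R w) - g p) / h) \<longlongrightarrow> germ_diff p (germ \<mm> g) w) (at_right 0)) \<and>
     (\<forall>g\<in>filter_ideal \<nn>. \<forall>w\<in>tangent_cone q.
        ((\<lambda>h. (g (q + h *\<^sub>R w) - g q) / h) \<longlongrightarrow> germ_diff q (germ \<nn> g) w) (at_right 0)) \<and>
     (\<forall>v\<in>tangent_cone p.
        ((\<lambda>h. (1 / h) *\<^sub>R (S (p + h *\<^sub>R v) - S p)) \<longlongrightarrow> tsujii_diff S p v) (at_right 0) \<and>
        tsujii_diff S p v \<in> tangent_cone q \<and>
        compose (carrier (germ_lgrp \<mm>)) (eval_at v) (germ_diff p)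
          \<in> lgroup_hom (germ_lgrp \<mm>) real_lgrp) \<and>
     (\<forall>v\<in>tangent_cone p.
        \<sigma>bar' (compose (carrier (germ_lgrp \<mm>)) (eval_at v) (germ_diff p)) =
        compose (carrier (germ_lgrp \<nn>)) (eval_at (tsujii_diff S p v)) (germ_diff q))"
proof -
  have S: "S = induced_map \<sigma>" and q: "q = S p" and \<mm>: "\<mm> = point_filter p"
    and \<nn>: "\<nn> = point_filter (induced_map \<sigma> p)" and \<sigma>: "\<sigma> \<in> mv_hom free_mv free_mv"
    and p: "p \<in> cube"
    and \<sigma>bar: "\<sigma>bar = germ_pullback (induced_map \<sigma>) (point_filter (induced_map \<sigma> p)) (point_filter p)"
    using assms by simp_all
  have q_cube: "q \<in> cube" using induced_map_cube[OF \<sigma>] p unfolding q S by blast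
  have lgroups: "lgroup (germ_lgrp \<mm>)" "lgroup (germ_lgrp \<nn>)"
    using lgroup_germ_lgrp[OF p] lgroup_germ_lgrp[OF q_cube] unfolding \<mm> \<nn> q S by simp_all
  have hom: "\<sigma>bar \<in> lgroup_hom (germ_lgrp \<nn>) (germ_lgrp \<mm>)"
    unfolding \<sigma>bar \<mm> \<nn> by (rule germ_pullback_lgroup_hom[OF \<sigma> p])
  have pull: "\<forall>g\<in>filter_ideal \<nn>. \<sigma>bar (germ \<nn> g) = germ \<mm> (compose cube g S)"
    unfolding \<sigma>bar \<mm> \<nn> S using germ_pullback_germ[OF \<sigma> p] by blast
  have hom': "\<sigma>bar' \<in> lgroup_hom (germ_lgrp \<mm>) real_lgrp \<rightarrow>\<^sub>E lgroup_hom (germ_lgrp \<nn>) real_lgrp"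
    unfolding assms(8) using lgroup_hom_compose[OF _ hom lgroups(2)] by auto
  have diff_p: "\<forall>g\<in>filter_ideal \<mm>. \<forall>w\<in>tangent_cone p.
      ((\<lambda>h. (g (p + h *\<^sub>R w) - g p) / h) \<longlongrightarrow> germ_diff p (germ \<mm> g) w) (at_right 0)"
    unfolding \<mm> using germ_diff_tendsto[OF p] by blast
  have diff_q: "\<forall>g\<in>filter_ideal \<nn>. \<forall>w\<in>tangent_cone q.
      ((\<lambda>h. (g (q + h *\<^sub>R w) - g q) / h) \<longlongrightarrow> germ_diff q (germ \<nn> g) w) (at_right 0)"
    using germ_diff_tendsto[OF q_cube] unfolding \<nn> q S by blast
  have tangent: "\<forall>v\<in>tangent_cone p.
      ((\<lambda>h. (1 / h) *\<^sub>R (S (p + h *\<^sub>R v) - S p)) \<longlongrightarrow> tsujii_diff S p v) (at_right 0) \<and>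
      tsujii_diff S p v \<in> tangent_cone q \<and>
      compose (carrier (germ_lgrp \<mm>)) (eval_at v) (germ_diff p) \<in> lgroup_hom (germ_lgrp \<mm>) real_lgrp"
    unfolding \<mm> S q
    using tsujii_diff_eventually(2,3)[OF \<sigma> p] eval_germ_diff_lgroup_hom[OF p] by blast
  have "\<sigma>bar' (compose (carrier (germ_lgrp \<mm>)) (eval_at v) (germ_diff p)) =
      compose (carrier (germ_lgrp \<nn>)) (eval_at (tsujii_diff S p v)) (germ_diff q)"
    if v: "v \<in> tangent_cone p" for v
  proof -
    have "\<sigma>bar' (compose (carrier (germ_lgrp \<mm>)) (eval_at v) (germ_diff p)) =
        compose (carrier (germ_lgrp \<nn>))
          (compose (carrier (germ_lgrp \<mm>)) (eval_at v) (germ_diff p)) \<sigma>bar"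
      unfolding assms(8) using tangent v by simp
    also have "\<dots> = compose (carrier (germ_lgrp \<nn>)) (eval_at (tsujii_diff S p v)) (germ_diff q)"
    proof (rule extensionalityI[OF compose_extensional compose_extensional])
      fix X assume X: "X \<in> carrier (germ_lgrp \<nn>)"
      then obtain g where g: "g \<in> filter_ideal \<nn>" "X = germ \<nn> g"
        unfolding germ_lgrp_carrier by blast
      have "\<sigma>bar X \<in> carrier (germ_lgrp \<mm>)" using hom X by (auto simp: lgroup_hom_def)
      moreover have "germ_diff p (\<sigma>bar X) v = germ_diff q X (tsujii_diff S p v)"
        using germ_diff_compose[OF \<sigma> p v] g pull unfolding \<nn> \<mm> q S by simp
      ultimately show "compose (carrier (germ_lgrp \<nn>))
            (compose (carrier (germ_lgrp \<mm>)) (eval_at v) (germ_diff p)) \<sigma>bar X =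
          compose (carrier (germ_lgrp \<nn>)) (eval_at (tsujii_diff S p v)) (germ_diff q) X"
        using X by (simp add: compose_eq eval_at_def)
    qed
    finally show ?thesis .
  qed
  with lgroups hom pull hom' diff_p diff_q tangent show ?thesis by blast
qed

end
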